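(* Let $\Sigma =\overline{\mathbf{C}}\setminus \{ \mathrm{i},-\mathrm{i}, \infty \}$ and, for $a,b\in\mathbf{R}$ satisfying $(a+1)(b+1)=8$, define on $\Sigma$ $$g_{1}(z)=\frac{z^2 +a}{z^2 -1},\qquad g_{2}(z)=\frac{z^2 +b}{z^2 -1},\qquad h\,dz= \frac{(z^2 -1)^2}{(z^2 +1)^2}\,dz .$$ Then there is a complete minimal surface $X\colon \Sigma \to \mathbf{R}^4$ whose Weierstrass data is $(g_1,g_2,h\,dz)$. In particular, this surface has finite total curvature, and the total weights of the totally ramified values of $g_1$ and of $g_2$ are $\nu_{g_{1}}=\nu_{g_{2}}=5/2$.
   Context: $\overline{\mathbf{C}}=\mathbf{C}\cup\{\infty\}$ is the Riemann sphere and $\mathrm{i}=\sqrt{-1}$. Weierstrass data in $\mathbf{R}^4$: given meromorphic functions $g_1,g_2$ and a holomorphic differential $h\,dz$ on a Riemann surface $\Sigma$, put $$\phi_1=\tfrac12(1+g_1g_2)h\,dz,\quad \phi_2=\tfrac{\mathrm{i}}2(1-g_1g_2)h\,dz,\quad \phi_3=\tfrac12(g_1-g_2)h\,dz,\quad \phi_4=-\tfrac{\mathrm{i}}2(g_1+g_2)h\,dz .$$ The triple $(g_1,g_2,h\,dz)$ is the Weierstrass data of a minimal surface $X\colon\Sigma\to\mathbf{R}^4$ if the $\phi_i$ are holomorphic without common zeros (equivalently, the zero divisor of $h\,dz$ is the sum of the polar divisors of $g_1$ and $g_2$), $\mathrm{Re}\int_c\phi_i=0$ for $i=1,2,3,4$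 and every cycle $c\in H_1(\Sigma,\mathbf{Z})$, and, up to translation, $X(z)=\mathrm{Re}\left(\int_{z_0}^z2\phi_1,\dots,\int_{z_0}^z2\phi_4\right)$ for a fixed $z_0\in\Sigma$. Then $g=(g_1,g_2)\colon\Sigma\to\overline{\mathbf{C}}\times\overline{\mathbf{C}}$ is the Gauss map of $X$, and the induced metric is $ds^2=|h|^2(1+|g_1|^2)(1+|g_2|^2)|dz|^2$. The surface is complete if all divergent paths in $\Sigma$ have infinite length with respect to $ds^2$. The total curvature is $\int_\Sigma K\,dA$, where $K$ is the Gauss curvature and $dA$ the area element of $ds^2$; it is finite if this integral is finite. Ramification: let $f\colon\Sigma\to\overline{\mathbf{C}}$ be a meromorphic function on a Riemann surface. A value that $f$ never attains on $\Sigma$ is an omitted value. For $\nu\in\mathbf{Z}\cup\{\infty\}$, $\nu\ge2$, a value $\alpha\in\overline{\mathbf{C}}$ is a totally ramified value of $f$ of order $\nu$ if the equation $f=\alpha$ has no root of multiplicity less than $\nu$ on $\Sigma$; omitted values are regarded as totally ramified of order $\infty$, and for an attained totally ramified value the order is the minimum of the multiplicities of the roots. The weight of a totally ramified value of order $\nu$ is $1-\frac1\nu$, and the total weight $\nu_f$ is the sum of the weights of all totally ramified values of $f$. *)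

theory Defs
  imports "HOL-Analysis.Analysis" "HOL-Complex_Analysis.Complex_Analysis"
    "HOL-Library.Extended_Nat"
begin

text \<open>
  The Riemann surfaces considered here are plane domains \<open>S\<close>, with the global coordinate
  \<open>z = x + \<i>y\<close>. A holomorphic differential \<open>h dz\<close> on \<open>S\<close> is represented by its coefficient \<open>h\<close>.
\<close>

subsection \<open>Immersed surfaces in Euclidean space, parametrized by a plane domain\<close>

text \<open>Directional derivative: \<open>pd 1\<close> and \<open>pd \<i>\<close> are the partial derivatives in \<open>x\<close> and \<open>y\<close>.\<close>

definition pd :: "complex \<Rightarrow> (complex \<Rightarrow> 'a::real_normed_vector) \<Rightarrow> complex \<Rightarrow> 'a" where
  "pd v f z = frechet_derivative f (at z) v"

primrec Ck_on :: "nat \<Rightarrow> (complex \<Rightarrow> 'a::real_normed_vector) \<Rightarrow> complex set \<Rightarrow> bool" where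
  "Ck_on 0 f S \<longleftrightarrow> continuous_on S f"
| "Ck_on (Suc k) f S \<longleftrightarrow>
     (\<forall>z\<in>S. f differentiable (at z)) \<and> Ck_on k (pd 1 f) S \<and> Ck_on k (pd \<i> f) S"

definition immersion_on :: "(complex \<Rightarrow> real ^ 'n) \<Rightarrow> complex set \<Rightarrow> bool" where
  "immersion_on X S \<longleftrightarrow>
     (\<forall>k. Ck_on k X S) \<and> (\<forall>z\<in>S. inj (frechet_derivative X (at z)))"

definition induced_metric ::
  "(complex \<Rightarrow> real ^ 'n) \<Rightarrow> complex \<Rightarrow> complex \<Rightarrow> complex \<Rightarrow> real" where
  "induced_metric X z u v = pd u X z \<bullet> pd v X z"

text \<open>\<open>ds\<^sup>2 = E dx\<^sup>2 + 2F dx dy + G dy\<^sup>2\<close>\<close>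

definition metric_E :: "(complex \<Rightarrow> real ^ 'n) \<Rightarrow> complex \<Rightarrow> real" where
  "metric_E X z = induced_metric X z 1 1"

definition metric_F :: "(complex \<Rightarrow> real ^ 'n) \<Rightarrow> complex \<Rightarrow> real" where
  "metric_F X z = induced_metric X z 1 \<i>"

definition metric_G :: "(complex \<Rightarrow> real ^ 'n) \<Rightarrow> complex \<Rightarrow> real" where
  "metric_G X z = induced_metric X z \<i> \<i>"

definition metric_det :: "(complex \<Rightarrow> real ^ 'n) \<Rightarrow> complex \<Rightarrow> real" where
  "metric_det X z = metric_E X z * metric_G X z - (metric_F X z)\<^sup>2"

text \<open>The component of the mean curvature vector along a normal vector \<open>N\<close>.\<close>

definition mean_curvature :: "(complex \<Rightarrow> real ^ 'n) \<Rightarrow> complex \<Rightarrow> real ^ 'n \<Rightarrow> real" where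
  "mean_curvature X z N =
     (metric_G X z * (pd 1 (pd 1 X) z \<bullet> N) - 2 * metric_F X z * (pd \<i> (pd 1 X) z \<bullet> N)
       + metric_E X z * (pd \<i> (pd \<i> X) z \<bullet> N)) / (2 * metric_det X z)"

definition minimal_surface_on :: "(complex \<Rightarrow> real ^ 'n) \<Rightarrow> complex set \<Rightarrow> bool" where
  "minimal_surface_on X S \<longleftrightarrow> immersion_on X S \<and>
     (\<forall>z\<in>S. \<forall>N. pd 1 X z \<bullet> N = 0 \<and> pd \<i> X z \<bullet> N = 0 \<longrightarrow> mean_curvature X z N = 0)"

text \<open>
  The Gauss curvature of \<open>ds\<^sup>2\<close>, by Brioschi's formula. For a conformal metric \<open>\<rho>|dz|\<^sup>2\<close> it
  reduces to \<open>K = -(\<Delta> ln \<rho>) / (2\<rho>)\<close>.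
\<close>

definition gauss_curvature :: "(complex \<Rightarrow> real ^ 'n) \<Rightarrow> complex \<Rightarrow> real" where
  "gauss_curvature X z =
    (let E = metric_E X; F = metric_F X; G = metric_G X;
         Ex = pd 1 E z; Ey = pd \<i> E z; Fx = pd 1 F z; Fy = pd \<i> F z;
         Gx = pd 1 G z; Gy = pd \<i> G z;
         Eyy = pd \<i> (pd \<i> E) z; Fxy = pd \<i> (pd 1 F) z; Gxx = pd 1 (pd 1 G) z
     in (det (vector [vector [- Eyy / 2 + Fxy - Gxx / 2, Ex / 2, Fx - Ey / 2],
                      vector [Fy - Gx / 2, E z, F z],
                      vector [Gy / 2, F z, G z]] :: real ^ 3 ^ 3)
       - det (vector [vector [0, Ey / 2, Gx / 2],
                      vector [Ey / 2, E z, F z],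
                      vector [Gx / 2, F z, G z]] :: real ^ 3 ^ 3))
       / (metric_det X z)\<^sup>2)"

text \<open>The total curvature is the integral of \<open>K dA\<close>, where \<open>dA = sqrt (EG - F\<^sup>2) dx dy\<close>.\<close>

definition finite_total_curvature :: "(complex \<Rightarrow> real ^ 'n) \<Rightarrow> complex set \<Rightarrow> bool" where
  "finite_total_curvature X S \<longleftrightarrow>
     set_integrable lborel S (\<lambda>z. gauss_curvature X z * sqrt (metric_det X z))"

text \<open>
  Divergent paths are parametrized by \<open>[0,1)\<close> and are piecewise continuously differentiable on
  every \<open>[0,b]\<close> with \<open>b < 1\<close>; they may have infinitely many corners accumulating at the end.
\<close>

definition divergent_path :: "complex set \<Rightarrow> (real \<Rightarrow> complex) \<Rightarrow> bool" where
  "divergent_path S \<gamma> \<longleftrightarrow>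
     (\<forall>b\<in>{0<..<1}. \<gamma> piecewise_C1_differentiable_on {0..b}) \<and> \<gamma> ` {0..<1} \<subseteq> S \<and>
     (\<forall>K. compact K \<and> K \<subseteq> S \<longrightarrow> (\<exists>t\<^sub>0\<in>{0..<1}. \<forall>t\<in>{t\<^sub>0..<1}. \<gamma> t \<notin> K))"

definition path_metric_length :: "(complex \<Rightarrow> real ^ 'n) \<Rightarrow> (real \<Rightarrow> complex) \<Rightarrow> ennreal" where
  "path_metric_length X \<gamma> =
     (\<integral>\<^sup>+ t\<in>{0..<1}. ennreal (sqrt (induced_metric X (\<gamma> t)
        (vector_derivative \<gamma> (at t)) (vector_derivative \<gamma> (at t)))) \<partial>lborel)"

definition complete_surface_on :: "(complex \<Rightarrow> real ^ 'n) \<Rightarrow> complex set \<Rightarrow> bool" where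
  "complete_surface_on X S \<longleftrightarrow>
     (\<forall>\<gamma>. divergent_path S \<gamma> \<longrightarrow> path_metric_length X \<gamma> = \<infinity>)"

subsection \<open>Weierstrass data\<close>

text \<open>
  The coefficients of \<open>\<phi>\<^sub>1, \<dots>, \<phi>\<^sub>4\<close>. The raw expressions have wrong values at the poles of
  \<open>g\<^sub>1\<close> and \<open>g\<^sub>2\<close> (where division by zero occurs), hence \<open>remove_sings\<close>.
\<close>

definition weierstrass_form ::
  "(complex \<Rightarrow> complex) \<Rightarrow> (complex \<Rightarrow> complex) \<Rightarrow> (complex \<Rightarrow> complex) \<Rightarrow> 4 \<Rightarrow> complex \<Rightarrow> complex"
where
  "weierstrass_form g\<^sub>1 g\<^sub>2 h k = remove_sings (\<lambda>z.
     if k = 1 then 1 / 2 * (1 + g\<^sub>1 z * g\<^sub>2 z) * h z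
     else if k = 2 then \<i> / 2 * (1 - g\<^sub>1 z * g\<^sub>2 z) * h z
     else if k = 3 then 1 / 2 * (g\<^sub>1 z - g\<^sub>2 z) * h z
     else - (\<i> / 2) * (g\<^sub>1 z + g\<^sub>2 z) * h z)"

text \<open>
  Cycles: since \<open>S\<close> is connected, every class in \<open>H\<^sub>1(S, \<int>)\<close> is represented by one closed
  piecewise \<open>C\<^sup>1\<close> path. The vector \<open>v\<close> is the translation.
\<close>

definition weierstrass_data_on ::
  "(complex \<Rightarrow> real ^ 4) \<Rightarrow> complex set \<Rightarrow>
   (complex \<Rightarrow> complex) \<Rightarrow> (complex \<Rightarrow> complex) \<Rightarrow> (complex \<Rightarrow> complex) \<Rightarrow> bool" where
  "weierstrass_data_on X S g\<^sub>1 g\<^sub>2 h \<longleftrightarrow>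
     open S \<and> connected S \<and> S \<noteq> {} \<and>
     g\<^sub>1 meromorphic_on S \<and> g\<^sub>2 meromorphic_on S \<and> h holomorphic_on S \<and>
     (\<forall>k. weierstrass_form g\<^sub>1 g\<^sub>2 h k holomorphic_on S) \<and>
     (\<forall>z\<in>S. \<exists>k. weierstrass_form g\<^sub>1 g\<^sub>2 h k z \<noteq> 0) \<and>
     (\<forall>c. valid_path c \<and> path_image c \<subseteq> S \<and> pathfinish c = pathstart c \<longrightarrow>
        (\<forall>k. Re (contour_integral c (weierstrass_form g\<^sub>1 g\<^sub>2 h k)) = 0)) \<and>
     (\<exists>z\<^sub>0\<in>S. \<exists>v. \<forall>\<gamma>. valid_path \<gamma> \<and> path_image \<gamma> \<subseteq> S \<and> pathstart \<gamma> = z\<^sub>0 \<longrightarrow>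
        X (pathfinish \<gamma>) =
          v + (\<chi> k. Re (contour_integral \<gamma> (\<lambda>w. 2 * weierstrass_form g\<^sub>1 g\<^sub>2 h k w))))"

subsection \<open>Ramification of meromorphic functions\<close>

datatype riemann_sphere = Fin complex | Infty

text \<open>
  The value of a meromorphic function as a map into the sphere; library functions carry a junk
  complex value at poles.
\<close>

definition sphere_value :: "(complex \<Rightarrow> complex) \<Rightarrow> complex \<Rightarrow> riemann_sphere" where
  "sphere_value f z = (if is_pole f z then Infty else Fin (remove_sings f z))"

text \<open>
  The multiplicity of the root \<open>z\<close> of \<open>f = \<alpha>\<close>; it is infinite where \<open>f\<close> is locally constant
  (\<open>zorder\<close> is unspecified there). A root of \<open>f = \<infinity>\<close> is a pole and is counted by pole order.
\<close>

fun root_multiplicity :: "(complex \<Rightarrow> complex) \<Rightarrow> riemann_sphere \<Rightarrow> complex \<Rightarrow> enat" where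
  "root_multiplicity f (Fin c) z =
     (if \<forall>\<^sub>F w in at z. f w = c then \<infinity> else enat (nat (zorder (\<lambda>w. f w - c) z)))"
| "root_multiplicity f Infty z = enat (nat (- zorder f z))"

definition totally_ramified ::
  "(complex \<Rightarrow> complex) \<Rightarrow> complex set \<Rightarrow> riemann_sphere \<Rightarrow> enat \<Rightarrow> bool" where
  "totally_ramified f S \<alpha> \<nu> \<longleftrightarrow> 2 \<le> \<nu> \<and>
     \<not> (\<exists>z\<in>S. sphere_value f z = \<alpha> \<and> root_multiplicity f \<alpha> z < \<nu>)"

text \<open>The minimal multiplicity of the roots; for an omitted value the infimum of \<open>{}\<close> is \<open>\<infinity>\<close>.\<close>

definition ramification_order ::
  "(complex \<Rightarrow> complex) \<Rightarrow> complex set \<Rightarrow> riemann_sphere \<Rightarrow> enat" where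
  "ramification_order f S \<alpha> = (INF z\<in>{z \<in> S. sphere_value f z = \<alpha>}. root_multiplicity f \<alpha> z)"

definition weight :: "enat \<Rightarrow> real" where
  "weight \<nu> = (case \<nu> of enat n \<Rightarrow> 1 - 1 / real n | \<infinity> \<Rightarrow> 1)"

text \<open>If there are infinitely many totally ramified values, this sum has the junk value 0.\<close>

definition total_weight :: "(complex \<Rightarrow> complex) \<Rightarrow> complex set \<Rightarrow> real" where
  "total_weight f S =
     (\<Sum>\<alpha>\<in>{\<alpha>. \<exists>\<nu>. totally_ramified f S \<alpha> \<nu>}. weight (ramification_order f S \<alpha>))"

end

theory Submission
  imports Defs "HOL-Probability.Sinc_Integral"
begin

text \<open>
  Write \<open>p = z\<^sup>2 - 1\<close>, \<open>q\<^sub>e = z\<^sup>2 + e\<close>, \<open>w = z\<^sup>2 + 1\<close>, and \<open>s = p / w\<close>, \<open>t\<^sub>e = q\<^sub>e / w\<close>. Then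
  \<open>g\<^sub>1 = t\<^sub>a / s\<close>, \<open>g\<^sub>2 = t\<^sub>b / s\<close>, \<open>h = s\<^sup>2\<close>, so that twice the Weierstrass forms are
  \<open>s\<^sup>2 + t\<^sub>a t\<^sub>b\<close>, \<open>\<i> (s\<^sup>2 - t\<^sub>a t\<^sub>b)\<close>, \<open>s (t\<^sub>a - t\<^sub>b)\<close>, \<open>-\<i> s (t\<^sub>a + t\<^sub>b)\<close>. These have no poles at \<open>\<plusminus>1\<close>
  any more and their squares add up to zero identically.

  \<^item> Existence of the surface. In partial fractions each form is the derivative of a rational function
    plus \<open>c / (z - \<i>) - c / (z + \<i>)\<close>. The condition \<open>(a + 1) (b + 1) = 8\<close> is exactly what makes every
    residue \<open>c\<close> real (it is \<open>0, -2, 0, 2\<close> for the four forms). A real residue has purely imaginary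
    periods, and the real part of the primitive is the single-valued function
    \<open>X = Re R + c (ln |z - \<i>| - ln |z + \<i>|)\<close>. The path integral of \<open>1 / (z - \<i>)\<close> is handled through
    the winding number, whose exponential is the quotient of the end points.

  \<^item> Minimality. The real part of a primitive of an isotropic curve is harmonic, and isotropy says that
    the induced metric is \<open>\<rho> |dz|\<^sup>2\<close> with \<open>\<rho>\<close> half the sum of the squared moduli. Here
    \<open>\<rho> = (|s|\<^sup>2 + |t\<^sub>a|\<^sup>2) (|s|\<^sup>2 + |t\<^sub>b|\<^sup>2)\<close>, which is positive because \<open>q\<^sub>e - p = e + 1\<close> is a nonzero
    constant for \<open>e = a\<close> and for \<open>e = b\<close>.

  \<^item> Completeness. A holomorphic function \<open>f\<close> with \<open>|f'| \<le> sqrt \<rho>\<close> varies by at most the length of the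
    path along which it is followed. The same constant \<open>q\<^sub>e - p\<close> gives \<open>sqrt \<rho> \<ge> 4 / |w|\<^sup>2\<close>, and
    \<open>sqrt \<rho>\<close> is at least \<open>1 / 4\<close>, so this applies to \<open>z / 4\<close>, \<open>1 / (4 (z - \<i>))\<close> and \<open>1 / (4 (z + \<i>))\<close>. All
    three stay bounded along a path of finite length, which is thereby confined to a compact subset
    of the domain and cannot be divergent.

  \<^item> Total curvature. By Brioschi's formula \<open>K \<rho> = -(\<Delta> ln \<rho>) / 2\<close>, and the logarithm turns the
    factorization of \<open>\<rho>\<close> into the sum over \<open>e\<close> of the terms
    \<open>-2 |s t\<^sub>e' - s' t\<^sub>e|\<^sup>2 / (|s|\<^sup>2 + |t\<^sub>e|\<^sup>2)\<^sup>2 = -8 (e + 1)\<^sup>2 |z|\<^sup>2 / (|p|\<^sup>2 + |q\<^sub>e|\<^sup>2)\<^sup>2\<close>.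
    The denominators vanish nowhere in the plane, and the terms decay like \<open>|z|\<close> to the power \<open>-6\<close>.

  \<^item> Ramification. Each of \<open>g\<^sub>1\<close>, \<open>g\<^sub>2\<close> is a fractional linear function of \<open>z\<^sup>2\<close>, so in the sphere it
    branches only over the images of \<open>0\<close> and \<open>\<infinity>\<close>. The value \<open>1\<close> at \<open>\<infinity>\<close> is omitted, the value at
    \<open>\<plusminus>\<i>\<close> is omitted since its only preimages are the two punctures, and the value at \<open>0\<close> is totally
    ramified of order 2. The weights are \<open>1 + 1 + 1 / 2\<close>.
\<close>

section \<open>Partial derivatives and smoothness of real parts of holomorphic functions\<close>

lemma pd_eq: "(f has_derivative D) (at z) \<Longrightarrow> pd v f z = D v"
  by (metis pd_def frechet_derivative_at)

text \<open>
  The partial derivatives are defined through a choice operator and are unspecified where the function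
  is not differentiable. On an open set they depend only on the values there, also in that case.
\<close>

lemma pd_cong:
  assumes "open S" "z \<in> S" "\<And>w. w \<in> S \<Longrightarrow> f w = g w"
  shows "pd v f z = pd v g z"
proof -
  have "(f has_derivative D) (at z) \<longleftrightarrow> (g has_derivative D) (at z)" for D
    using assms has_derivative_transform_within_open by (metis (no_types, lifting))
  then show ?thesis
    by (simp add: pd_def frechet_derivative_def)
qed

lemma Ck_on_cong:
  assumes "open S" "Ck_on k f S" "\<And>w. w \<in> S \<Longrightarrow> f w = g w"
  shows "Ck_on k g S"
  using assms(2,3)
proof (induction k arbitrary: f g)
  case 0
  then show ?case by (metis Ck_on.simps(1) continuous_on_cong)
next
  case (Suc k)
  have "g differentiable (at z)" if "z \<in> S" for z
    using Suc.prems that assms(1) by (metis Ck_on.simps(2) differentiable_def has_derivative_transform_within_open)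
  moreover have "Ck_on k (pd v g) S" if "v = 1 \<or> v = \<i>" for v
  proof (rule Suc.IH)
    show "Ck_on k (pd v f) S"
      using Suc.prems(1) that by auto
    show "pd v f w = pd v g w" if "w \<in> S" for w
      using pd_cong[OF assms(1) that] Suc.prems(2) by blast
  qed
  ultimately show ?case
    by simp
qed

lemma has_derivative_vec:
  fixes f :: "'a::real_normed_vector \<Rightarrow> real ^ 'n"
  assumes "\<And>k. ((\<lambda>x. f x $ k) has_derivative (\<lambda>v. D v $ k)) (at x within S)"
  shows "(f has_derivative D) (at x within S)"
proof (subst has_derivative_componentwise_within, rule ballI)
  fix i :: "real ^ 'n" assume "i \<in> Basis"
  then obtain k where "i = axis k 1" by (auto simp: Basis_vec_def)
  then show "((\<lambda>x. f x \<bullet> i) has_derivative (\<lambda>x. D x \<bullet> i)) (at x within S)"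
    using assms[of k] by (simp add: inner_axis)
qed

lemma has_derivative_Re_vec:
  assumes "\<And>k. (F k has_field_derivative F' k) (at z)"
  shows "((\<lambda>w. \<chi> k. Re (F k w)) has_derivative (\<lambda>v. \<chi> k. Re (F' k * v))) (at z)"
proof (rule has_derivative_vec)
  show "((\<lambda>w. (\<chi> k. Re (F k w)) $ k) has_derivative (\<lambda>v. (\<chi> k. Re (F' k * v)) $ k)) (at z)" for k
    using has_derivative_Re[OF assms[unfolded has_field_derivative_def, of k]] by simp
qed

text \<open>
  The induction closes because a partial derivative of \<open>Re F\<close> in the direction \<open>v\<close> is again the real
  part of a holomorphic function, namely of \<open>F' v\<close>.
\<close>

lemma Ck_on_Re_holomorphic:
  assumes "open S" "\<And>k. F k holomorphic_on S"
  shows "Ck_on n (\<lambda>z. \<chi> k. Re (F k z)) S"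
  using assms(2)
proof (induction n arbitrary: F)
  case 0
  then show ?case
    by (auto intro!: continuous_intros dest: holomorphic_on_imp_continuous_on)
next
  case (Suc n)
  have D: "((\<lambda>w. \<chi> k. Re (F k w)) has_derivative (\<lambda>v. \<chi> k. Re (deriv (F k) z * v))) (at z)"
    if "z \<in> S" for z
    using that Suc.prems assms(1) by (intro has_derivative_Re_vec) (metis holomorphic_derivI)
  have "Ck_on n (pd v (\<lambda>w. \<chi> k. Re (F k w))) S" for v
  proof (rule Ck_on_cong[OF assms(1)])
    show "Ck_on n (\<lambda>z. \<chi> k. Re (deriv (F k) z * v)) S"
      using Suc.prems assms(1) by (intro Suc.IH holomorphic_intros) auto
    show "(\<chi> k. Re (deriv (F k) w * v)) = pd v (\<lambda>w. \<chi> k. Re (F k w)) w" if "w \<in> S" for w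
      using pd_eq[OF D[OF that]] by simp
  qed
  then show ?case
    using D by (auto simp: differentiable_def)
qed

section \<open>Minimal surfaces as real parts of isotropic curves\<close>

text \<open>
  The classical integrated form of the Weierstrass representation: \<open>F\<close> is the derivative of an
  isotropic holomorphic curve whose real part is \<open>X\<close>. The curve itself may be multivalued, so only its
  derivative and the single-valued real part appear.
\<close>

locale isotropic_curve =
  fixes S :: "complex set" and X :: "complex \<Rightarrow> real ^ 'n" and F :: "'n \<Rightarrow> complex \<Rightarrow> complex"
  assumes open_S: "open S"
    and holo: "\<And>k. F k holomorphic_on S"
    and deriv_X: "\<And>z. z \<in> S \<Longrightarrow> (X has_derivative (\<lambda>v. \<chi> k. Re (F k z * v))) (at z)"
    and isotropic: "\<And>z. z \<in> S \<Longrightarrow> (\<Sum>k\<in>UNIV. (F k z)\<^sup>2) = 0"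
    and no_common_zero: "\<And>z. z \<in> S \<Longrightarrow> \<exists>k. F k z \<noteq> 0"
begin

text \<open>The factor in the induced metric \<open>\<rho> |dz|\<^sup>2\<close>; see the conformality lemma below.\<close>

definition \<rho> :: "complex \<Rightarrow> real" where
  "\<rho> z = (\<Sum>k\<in>UNIV. (norm (F k z))\<^sup>2) / 2"

lemma \<rho>_pos: "\<rho> z > 0" if z: "z \<in> S"
proof -
  obtain k where "F k z \<noteq> 0" using no_common_zero[OF z] ..
  then show ?thesis unfolding \<rho>_def
    by (intro divide_pos_pos sum_pos2[of _ k]) auto
qed

lemma pd_X: "z \<in> S \<Longrightarrow> pd v X z = (\<chi> k. Re (F k z * v))"
  by (rule pd_eq[OF deriv_X])

text \<open>
  Conformality. The product \<open>Re (F u) Re (F v)\<close> is \<open>|F|\<^sup>2 (u \<bullet> v) / 2\<close> up to the term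
  \<open>Re (F\<^sup>2 u v) / 2\<close>, and these terms cancel in the sum by isotropy.
\<close>

lemma induced_metric_eq:
  assumes z: "z \<in> S"
  shows "induced_metric X z u v = \<rho> z * (u \<bullet> v)"
proof -
  have *: "Re (F k z * u) * Re (F k z * v)
      = ((norm (F k z))\<^sup>2 * (u \<bullet> v) + Re ((F k z)\<^sup>2 * (u * v))) / 2" for k
    by (simp only: cmod_power2) (simp add: inner_complex_def power2_eq_square algebra_simps)
  have "induced_metric X z u v = (\<Sum>k\<in>UNIV. Re (F k z * u) * Re (F k z * v))"
    by (simp add: induced_metric_def pd_X[OF z] inner_vec_def)
  also have "\<dots> = \<rho> z * (u \<bullet> v) + Re ((\<Sum>k\<in>UNIV. (F k z)\<^sup>2) * (u * v)) / 2"
    unfolding * \<rho>_def sum_distrib_right Re_sum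
    by (simp add: sum.distrib sum_divide_distrib[symmetric] sum_distrib_right add_divide_distrib)
  finally show ?thesis
    by (simp add: isotropic[OF z])
qed

lemma metric_eqs:
  assumes "z \<in> S"
  shows "metric_E X z = \<rho> z" "metric_F X z = 0" "metric_G X z = \<rho> z" "metric_det X z = (\<rho> z)\<^sup>2"
  using assms by (simp_all add: metric_E_def metric_F_def metric_G_def metric_det_def
      induced_metric_eq power2_eq_square)

lemma Ck_X: "Ck_on k X S"
proof (cases k)
  case 0
  then show ?thesis
    using has_derivative_continuous[OF deriv_X] by (simp add: continuous_at_imp_continuous_on)
next
  case (Suc n)
  have "Ck_on n (pd v X) S" for v
  proof (rule Ck_on_cong[OF open_S])
    show "Ck_on n (\<lambda>z. \<chi> k. Re (F k z * v)) S"
      using holo by (intro Ck_on_Re_holomorphic open_S holomorphic_intros)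
  qed (simp add: pd_X)
  then show ?thesis
    using deriv_X Suc by (auto simp: differentiable_def)
qed

lemma immersion: "immersion_on X S"
proof -
  have "inj (frechet_derivative X (at z))" if z: "z \<in> S" for z
  proof -
    let ?D = "frechet_derivative X (at z)"
    have lin: "linear ?D"
      using deriv_X[OF z] by (metis differentiable_def linear_frechet_derivative)
    have "v = 0" if "?D v = 0" for v
      using induced_metric_eq[OF z, of v v] that \<rho>_pos[OF z]
      by (simp add: induced_metric_def pd_def)
    then show ?thesis
      using lin linear_injective_0 by blast
  qed
  then show ?thesis
    by (simp add: immersion_on_def Ck_X)
qed

lemma pd_pd_X:
  assumes z: "z \<in> S"
  shows "pd u (pd v X) z = (\<chi> k. Re (deriv (F k) z * v * u))"
proof -
  have "((\<lambda>w. \<chi> k. Re (F k w * v)) has_derivative (\<lambda>u. \<chi> k. Re (deriv (F k) z * v * u))) (at z)"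
    using holo open_S z
    by (intro has_derivative_Re_vec) (auto intro!: derivative_eq_intros holomorphic_derivI)
  then have "pd u (\<lambda>w. \<chi> k. Re (F k w * v)) z = (\<chi> k. Re (deriv (F k) z * v * u))"
    by (rule pd_eq)
  then show ?thesis
    using pd_cong[OF open_S z, of "pd v X" "\<lambda>w. \<chi> k. Re (F k w * v)" u] by (simp add: pd_X)
qed

text \<open>
  In isothermal coordinates the mean curvature vector is a multiple of the Laplacian of \<open>X\<close>, which
  vanishes because \<open>X\<close> is the real part of a holomorphic map.
\<close>

lemma minimal: "minimal_surface_on X S"
proof -
  have "mean_curvature X z N = 0" if z: "z \<in> S" for z N
  proof -
    have "pd \<i> (pd \<i> X) z = - pd 1 (pd 1 X) z"
      by (simp add: pd_pd_X[OF z] vec_eq_iff)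
    then show ?thesis
      by (simp add: mean_curvature_def metric_eqs[OF z])
  qed
  then show ?thesis
    by (simp add: minimal_surface_on_def immersion)
qed

text \<open>
  Brioschi's formula for \<open>E = G = \<rho>\<close> and \<open>F = 0\<close>. The metric coefficients agree with these functions
  only on \<open>S\<close>, which suffices for their derivatives since \<open>S\<close> is open.
\<close>

lemma gauss_curvature_isothermal:
  assumes z: "z \<in> S"
  shows "gauss_curvature X z =
    ((pd 1 \<rho> z)\<^sup>2 + (pd \<i> \<rho> z)\<^sup>2 - \<rho> z * (pd 1 (pd 1 \<rho>) z + pd \<i> (pd \<i> \<rho>) z)) / (2 * \<rho> z ^ 3)"
proof -
  have E: "pd v (metric_E X) w = pd v \<rho> w" "pd v (metric_G X) w = pd v \<rho> w"
    "pd v (metric_F X) w = 0" if "w \<in> S" for v w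
    using pd_cong[OF open_S that, of "metric_E X" \<rho>] pd_cong[OF open_S that, of "metric_G X" \<rho>]
      pd_cong[OF open_S that, of "metric_F X" "\<lambda>_. 0"] metric_eqs pd_eq[OF has_derivative_const[of 0 "at w"]]
    by auto
  have E2: "pd u (pd v (metric_E X)) z = pd u (pd v \<rho>) z"
    "pd u (pd v (metric_G X)) z = pd u (pd v \<rho>) z"
    "pd u (pd v (metric_F X)) z = 0" for u v
    using pd_cong[OF open_S z, of "pd v (metric_E X)" "pd v \<rho>"]
      pd_cong[OF open_S z, of "pd v (metric_G X)" "pd v \<rho>"]
      pd_cong[OF open_S z, of "pd v (metric_F X)" "\<lambda>_. 0"] E pd_eq[OF has_derivative_const[of 0 "at z"]]
    by auto
  have alg: "(det (vector [vector [- Eyy / 2 - Exx / 2, Ex / 2, - Ey / 2],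
      vector [- Ex / 2, r, 0], vector [Ey / 2, 0, r]] :: real ^ 3 ^ 3)
    - det (vector [vector [0, Ey / 2, Ex / 2], vector [Ey / 2, r, 0],
        vector [Ex / 2, 0, r]] :: real ^ 3 ^ 3)) / (r\<^sup>2)\<^sup>2
    = (Ex\<^sup>2 + Ey\<^sup>2 - r * (Exx + Eyy)) / (2 * r ^ 3)" if "r > 0" for r Ex Ey Exx Eyy :: real
    using that by (simp add: det_3 field_simps power2_eq_square power3_eq_cube)
  show ?thesis
    unfolding gauss_curvature_def Let_def
    using alg[OF \<rho>_pos[OF z], of "pd \<i> (pd \<i> \<rho>) z" "pd 1 (pd 1 \<rho>) z" "pd 1 \<rho> z" "pd \<i> \<rho> z"]
    by (simp add: E[OF z] E2 metric_eqs[OF z])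
qed

end

section \<open>The curvature density of a factorized metric\<close>

lemma pd_add:
  assumes "f differentiable (at z)" "g differentiable (at z)"
  shows "pd v (\<lambda>w. f w + g w) z = pd v f z + pd v g z"
  unfolding pd_def using assms
  by (intro pd_eq[unfolded pd_def] has_derivative_add) (auto simp: frechet_derivative_works[symmetric])

lemma pd_mult:
  fixes f g :: "complex \<Rightarrow> real"
  assumes "f differentiable (at z)" "g differentiable (at z)"
  shows "pd v (\<lambda>w. f w * g w) z = f z * pd v g z + pd v f z * g z"
proof -
  have "((\<lambda>w. f w * g w) has_derivative
      (\<lambda>v. f z * frechet_derivative g (at z) v + frechet_derivative f (at z) v * g z)) (at z)"
    using assms by (intro has_derivative_mult) (auto simp: frechet_derivative_works[symmetric])
  from pd_eq[OF this] show ?thesis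
    by (simp add: pd_def)
qed

text \<open>
  This is \<open>f\<^sup>2 \<Delta> (ln f)\<close> with denominators cleared, a form that needs no differentiation of
  the logarithm.
\<close>

definition log_laplacian :: "(complex \<Rightarrow> real) \<Rightarrow> complex \<Rightarrow> real" where
  "log_laplacian f z = f z * (pd 1 (pd 1 f) z + pd \<i> (pd \<i> f) z) - ((pd 1 f z)\<^sup>2 + (pd \<i> f z)\<^sup>2)"

lemma log_laplacian_cong:
  assumes "open S" "z \<in> S" "\<And>w. w \<in> S \<Longrightarrow> f w = g w"
  shows "log_laplacian f z = log_laplacian g z"
proof -
  have "pd v f w = pd v g w" if "w \<in> S" for v w
    using pd_cong[OF assms(1) that] assms(3) by blast
  then show ?thesis
    using pd_cong[OF assms(1,2), of "pd v f" "pd v g" u for u v] assms(2,3)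
    by (simp add: log_laplacian_def)
qed

text \<open>Additivity of \<open>\<Delta> (ln f)\<close>, multiplied by the square of the product.\<close>

lemma log_laplacian_mult:
  assumes "open S" "z \<in> S"
    and f: "\<And>w. w \<in> S \<Longrightarrow> f differentiable (at w)" "\<And>v. pd v f differentiable (at z)"
    and g: "\<And>w. w \<in> S \<Longrightarrow> g differentiable (at w)" "\<And>v. pd v g differentiable (at z)"
  shows "log_laplacian (\<lambda>w. f w * g w) z = log_laplacian f z * (g z)\<^sup>2 + (f z)\<^sup>2 * log_laplacian g z"
proof -
  have 1: "pd v (\<lambda>w. f w * g w) w = f w * pd v g w + pd v f w * g w" if "w \<in> S" for v w
    using that f(1) g(1) by (intro pd_mult)
  have 2: "pd v (pd v (\<lambda>w. f w * g w)) z
      = f z * pd v (pd v g) z + 2 * (pd v f z * pd v g z) + pd v (pd v f) z * g z" for v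
  proof -
    have "pd v (pd v (\<lambda>w. f w * g w)) z = pd v (\<lambda>w. f w * pd v g w + pd v f w * g w) z"
      using 1 by (rule pd_cong[OF assms(1,2)])
    also have "\<dots> = f z * pd v (pd v g) z + 2 * (pd v f z * pd v g z) + pd v (pd v f) z * g z"
      using assms by (subst pd_add, simp_all add: pd_mult)
    finally show ?thesis .
  qed
  show ?thesis
    unfolding log_laplacian_def 1[OF assms(2)] 2
    by (simp add: algebra_simps power2_eq_square)
qed

lemma norm_sq_sum_differentiable:
  assumes "open S" "z \<in> S" "s holomorphic_on S" "t holomorphic_on S"
  shows pd_norm_sq_sum: "pd v (\<lambda>w. (norm (s w))\<^sup>2 + (norm (t w))\<^sup>2) z
      = 2 * (s z \<bullet> (deriv s z * v) + t z \<bullet> (deriv t z * v))"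
    and "(\<lambda>w. (norm (s w))\<^sup>2 + (norm (t w))\<^sup>2) differentiable (at z)"
proof -
  have "(s has_derivative (*) (deriv s z)) (at z)" "(t has_derivative (*) (deriv t z)) (at z)"
    using assms holomorphic_derivI by (auto simp: has_field_derivative_def[symmetric])
  then have "((\<lambda>w. (norm (s w))\<^sup>2 + (norm (t w))\<^sup>2) has_derivative
      (\<lambda>v. 2 * (s z \<bullet> (deriv s z * v) + t z \<bullet> (deriv t z * v)))) (at z)"
    unfolding power2_norm_eq_inner
    by (auto intro!: derivative_eq_intros simp: inner_commute)
  from pd_eq[OF this] differentiableI[OF this]
  show "pd v (\<lambda>w. (norm (s w))\<^sup>2 + (norm (t w))\<^sup>2) z
      = 2 * (s z \<bullet> (deriv s z * v) + t z \<bullet> (deriv t z * v))"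
    "(\<lambda>w. (norm (s w))\<^sup>2 + (norm (t w))\<^sup>2) differentiable (at z)" by auto
qed

lemma norm_sq_sum_pd_differentiable:
  assumes "open S" "z \<in> S" "s holomorphic_on S" "t holomorphic_on S"
  shows pd_pd_norm_sq_sum: "pd u (pd v (\<lambda>w. (norm (s w))\<^sup>2 + (norm (t w))\<^sup>2)) z
      = 2 * ((deriv s z * u) \<bullet> (deriv s z * v) + s z \<bullet> (deriv (deriv s) z * u * v)
         + ((deriv t z * u) \<bullet> (deriv t z * v) + t z \<bullet> (deriv (deriv t) z * u * v)))" (is "_ = ?D u")
    and "pd v (\<lambda>w. (norm (s w))\<^sup>2 + (norm (t w))\<^sup>2) differentiable (at z)"
proof -
  have [derivative_intros]: "(s has_derivative (*) (deriv s z)) (at z)" "(t has_derivative (*) (deriv t z)) (at z)"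
    "(deriv s has_derivative (*) (deriv (deriv s) z)) (at z)"
    "(deriv t has_derivative (*) (deriv (deriv t) z)) (at z)"
    using holomorphic_derivI[OF _ assms(1,2)] assms(3,4) holomorphic_deriv[OF _ assms(1)]
    by (auto simp: has_field_derivative_def[symmetric])
  have "((\<lambda>w. 2 * (s w \<bullet> (deriv s w * v) + t w \<bullet> (deriv t w * v))) has_derivative ?D) (at z)"
    by (auto intro!: derivative_eq_intros ext)
  then have "(pd v (\<lambda>w. (norm (s w))\<^sup>2 + (norm (t w))\<^sup>2) has_derivative ?D) (at z)"
    using assms(1,2) by (rule has_derivative_transform_within_open) (simp add: pd_norm_sq_sum[OF assms(1) _ assms(3,4)])
  from pd_eq[OF this] differentiableI[OF this]
  show "pd u (pd v (\<lambda>w. (norm (s w))\<^sup>2 + (norm (t w))\<^sup>2)) z = ?D u"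
    "pd v (\<lambda>w. (norm (s w))\<^sup>2 + (norm (t w))\<^sup>2) differentiable (at z)" by auto
qed

text \<open>
  With \<open>\<Delta> |s|\<^sup>2 = 4 |s'|\<^sup>2\<close> and the gradient of \<open>|s|\<^sup>2\<close> given by \<open>2 cnj s s'\<close>, this is Lagrange's identity
  for the vectors \<open>(s, t)\<close> and \<open>(s', t')\<close>: only their Wronskian remains.
\<close>

lemma log_laplacian_norm_sq_sum:
  assumes "open S" "z \<in> S" "s holomorphic_on S" "t holomorphic_on S"
  shows "log_laplacian (\<lambda>w. (norm (s w))\<^sup>2 + (norm (t w))\<^sup>2) z
    = 4 * (norm (s z * deriv t z - t z * deriv s z))\<^sup>2"
  unfolding log_laplacian_def pd_norm_sq_sum[OF assms] pd_pd_norm_sq_sum[OF assms]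
  by (simp only: cmod_power2) (simp add: inner_complex_def power2_eq_square algebra_simps)

text \<open>
  The left-hand side is \<open>K \<rho> = -(\<Delta> ln \<rho>) / 2\<close>. Since both factors of \<open>\<rho>\<close> are sums of two squared
  moduli of holomorphic functions, each contributes the square of a Wronskian.
\<close>

lemma (in isotropic_curve) curvature_density:
  assumes z: "z \<in> S" and hol: "s holomorphic_on S" "t\<^sub>1 holomorphic_on S" "t\<^sub>2 holomorphic_on S"
    and fact: "\<And>w. w \<in> S \<Longrightarrow>
      \<rho> w = ((norm (s w))\<^sup>2 + (norm (t\<^sub>1 w))\<^sup>2) * ((norm (s w))\<^sup>2 + (norm (t\<^sub>2 w))\<^sup>2)"
  shows "gauss_curvature X z * sqrt (metric_det X z) =
    - 2 * ((norm (s z * deriv t\<^sub>1 z - t\<^sub>1 z * deriv s z))\<^sup>2 / ((norm (s z))\<^sup>2 + (norm (t\<^sub>1 z))\<^sup>2)\<^sup>2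
         + (norm (s z * deriv t\<^sub>2 z - t\<^sub>2 z * deriv s z))\<^sup>2 / ((norm (s z))\<^sup>2 + (norm (t\<^sub>2 z))\<^sup>2)\<^sup>2)"
proof -
  let ?f = "\<lambda>t w. (norm (s w))\<^sup>2 + (norm (t w))\<^sup>2"
  note diffs = norm_sq_sum_differentiable(2)[OF open_S] norm_sq_sum_pd_differentiable(2)[OF open_S]
  have pos: "?f t\<^sub>1 z > 0" "?f t\<^sub>2 z > 0"
    using \<rho>_pos[OF z] fact[OF z] by (auto simp: zero_less_mult_iff not_less add_nonneg_nonneg
        dest: less_le_trans[OF _ add_nonneg_nonneg[OF zero_le_power2 zero_le_power2]])
  have "log_laplacian \<rho> z = log_laplacian (\<lambda>w. ?f t\<^sub>1 w * ?f t\<^sub>2 w) z"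
    using fact by (rule log_laplacian_cong[OF open_S z])
  also have "\<dots> = log_laplacian (?f t\<^sub>1) z * (?f t\<^sub>2 z)\<^sup>2 + (?f t\<^sub>1 z)\<^sup>2 * log_laplacian (?f t\<^sub>2) z"
    using z hol by (intro log_laplacian_mult[OF open_S]) (auto intro: diffs)
  finally have L': "log_laplacian \<rho> z = 4 * (norm (s z * deriv t\<^sub>1 z - t\<^sub>1 z * deriv s z))\<^sup>2 * (?f t\<^sub>2 z)\<^sup>2
      + (?f t\<^sub>1 z)\<^sup>2 * (4 * (norm (s z * deriv t\<^sub>2 z - t\<^sub>2 z * deriv s z))\<^sup>2)"
    using hol by (simp add: log_laplacian_norm_sq_sum[OF open_S z])
  have alg: "(4 * u * q\<^sup>2 + p\<^sup>2 * (4 * v)) / (2 * (p * q)\<^sup>2) = 2 * (u / p\<^sup>2 + v / q\<^sup>2)"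
    if "p > 0" "q > 0" for p q u v :: real
    using that by (simp add: field_simps)
  have L: "log_laplacian \<rho> z / (2 * (\<rho> z)\<^sup>2) =
      2 * ((norm (s z * deriv t\<^sub>1 z - t\<^sub>1 z * deriv s z))\<^sup>2 / (?f t\<^sub>1 z)\<^sup>2
         + (norm (s z * deriv t\<^sub>2 z - t\<^sub>2 z * deriv s z))\<^sup>2 / (?f t\<^sub>2 z)\<^sup>2)"
    unfolding L' fact[OF z] using pos by (rule alg)
  have "gauss_curvature X z * sqrt (metric_det X z) = - (log_laplacian \<rho> z / (2 * (\<rho> z)\<^sup>2))"
    using \<rho>_pos[OF z] by (simp add: gauss_curvature_isothermal[OF z] metric_eqs[OF z]
        log_laplacian_def field_simps power2_eq_square power3_eq_cube)
  then show ?thesis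
    unfolding L by simp
qed

section \<open>A criterion for completeness\<close>

text \<open>
  For a piecewise continuously differentiable path the fundamental theorem of calculus holds as a gauge
  integral. The passage to the Lebesgue integral uses the right-hand side itself: if it is infinite the
  inequality is trivial, and otherwise its finiteness is absolute integrability of the derivative.
\<close>

lemma norm_increment_le_nn_integral:
  assumes "open S" "f holomorphic_on S" "0 \<le> b"
    and \<gamma>: "\<gamma> piecewise_C1_differentiable_on {0..b}" "\<gamma> ` {0..b} \<subseteq> S"
  shows "ennreal (norm (f (\<gamma> b) - f (\<gamma> 0)))
    \<le> (\<integral>\<^sup>+ t\<in>{0..b}. ennreal (norm (deriv f (\<gamma> t) * vector_derivative \<gamma> (at t))) \<partial>lborel)"
    (is "_ \<le> ?I")
proof (cases "?I = \<infinity>")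
  case True
  then show ?thesis by simp
next
  case False
  obtain T where T: "finite T" "\<gamma> C1_differentiable_on {0..b} - T"
    using \<gamma>(1) by (auto simp: piecewise_C1_differentiable_on_def)
  \<comment> \<open>On \<open>J\<close> the one-sided derivatives in the gauge integral agree with the two-sided ones, and the
    integrand is continuous, hence measurable. The removed points form a finite set.\<close>
  define J where "J = {0<..<b} - T"
  define v where "v t = deriv f (\<gamma> t) * vector_derivative \<gamma> (at t)" for t
  have fin: "finite ({0, b} \<union> T)"
    using T by simp
  have Jsub: "J \<subseteq> {0..b} - T" "J \<subseteq> {0..b}"
    by (auto simp: J_def)
  have diff: "\<gamma> differentiable (at t)" if "t \<in> J" for t
    using T(2) that Jsub by (auto simp: C1_differentiable_on_eq)
  have "((\<lambda>t. deriv f (\<gamma> t) * vector_derivative \<gamma> (at t within {0..b}))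
      has_integral (f (\<gamma> b) - f (\<gamma> 0))) {0..b}"
    using assms piecewise_C1_imp_differentiable
    by (intro contour_integral_primitive_lemma[of _ _ S])
      (auto intro: has_field_derivative_at_within holomorphic_derivI)
  then have "((\<lambda>t. indicator J t *\<^sub>R v t) has_integral (f (\<gamma> b) - f (\<gamma> 0))) {0..b}"
  proof (rule has_integral_spike_finite[OF fin, rotated])
    fix t assume "t \<in> {0..b} - ({0, b} \<union> T)"
    then have t: "t \<in> J" "0 < t" "t < b" by (auto simp: J_def)
    have "at t within {0..b} = at t"
      using t by (intro at_within_interior) auto
    then show "indicator J t *\<^sub>R v t = deriv f (\<gamma> t) * vector_derivative \<gamma> (at t within {0..b})"
      using t by (simp add: v_def)
  qed
  moreover have "(if t \<in> {0..b} then indicator J t *\<^sub>R v t else 0) = indicator J t *\<^sub>R v t" for t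
    using Jsub by (auto simp: indicator_def)
  ultimately have HK: "((\<lambda>t. indicator J t *\<^sub>R v t) has_integral (f (\<gamma> b) - f (\<gamma> 0))) UNIV"
    by (subst (asm) has_integral_restrict_UNIV[symmetric]) simp
  have "continuous_on J v"
    unfolding v_def
  proof (intro continuous_intros)
    show "continuous_on J (\<lambda>t. deriv f (\<gamma> t))"
    proof (rule continuous_on_compose2[of S "deriv f" J \<gamma>])
      show "continuous_on S (deriv f)"
        using assms by (intro holomorphic_on_imp_continuous_on holomorphic_deriv)
      show "continuous_on J \<gamma>"
        using diff by (intro continuous_at_imp_continuous_on ballI differentiable_imp_continuous_within)
    qed (use \<gamma>(2) Jsub in auto)
    show "continuous_on J (\<lambda>t. vector_derivative \<gamma> (at t))"
      using T(2) Jsub by (auto simp: C1_differentiable_on_eq intro: continuous_on_subset)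
  qed
  moreover have "J \<in> sets borel"
    using T(1) by (auto simp: J_def finite_imp_closed)
  ultimately have meas: "(\<lambda>t. indicator J t *\<^sub>R v t) \<in> borel_measurable lborel"
    by (simp add: borel_measurable_continuous_on_indicator)
  have le: "(\<integral>\<^sup>+ t. ennreal (norm (indicator J t *\<^sub>R v t)) \<partial>lborel) \<le> ?I"
    using Jsub by (intro nn_integral_mono) (auto simp: indicator_def v_def)
  have int: "integrable lborel (\<lambda>t. indicator J t *\<^sub>R v t)"
    using meas le False by (intro integrableI_bounded) (auto simp: less_top[symmetric] top_unique)
  have "f (\<gamma> b) - f (\<gamma> 0) = (\<integral> t. indicator J t *\<^sub>R v t \<partial>lborel)"
    using has_integral_unique[OF HK has_integral_integral_lborel[OF int]] .
  then have "ennreal (norm (f (\<gamma> b) - f (\<gamma> 0))) \<le> (\<integral>\<^sup>+ t. ennreal (norm (indicator J t *\<^sub>R v t)) \<partial>lborel)"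
    using integral_norm_bound_ennreal[OF int] by simp
  then show ?thesis
    using le by (rule order_trans)
qed

text \<open>
  Along a path of finite length every \<open>f\<close> in the family varies by at most that length, so all of them
  stay bounded. Properness of the family then confines the path to a compact set, contrary to
  divergence. The derivative bound has constant 1; other constants are absorbed by rescaling \<open>f\<close>.
\<close>

lemma (in isotropic_curve) complete_if_bounded_derivs:
  assumes "finite \<F>" and hol: "\<And>f. f \<in> \<F> \<Longrightarrow> f holomorphic_on S"
    and deriv_le: "\<And>f z. f \<in> \<F> \<Longrightarrow> z \<in> S \<Longrightarrow> norm (deriv f z) \<le> sqrt (\<rho> z)"
    and proper: "\<And>M. \<exists>K. compact K \<and> K \<subseteq> S \<and> {z \<in> S. \<forall>f\<in>\<F>. norm (f z) \<le> M} \<subseteq> K"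
  shows "complete_surface_on X S"
proof -
  have False if \<gamma>: "divergent_path S \<gamma>" and L: "path_metric_length X \<gamma> \<noteq> \<infinity>" for \<gamma>
  proof -
    have \<gamma>S: "\<gamma> t \<in> S" if "t \<in> {0..<1}" for t
      using \<gamma> that by (auto simp: divergent_path_def)
    obtain l where l: "path_metric_length X \<gamma> = ennreal l" "l \<ge> 0"
      using L by (cases "path_metric_length X \<gamma>") auto
    have incr: "norm (f (\<gamma> b) - f (\<gamma> 0)) \<le> l" if f: "f \<in> \<F>" and b: "b \<in> {0<..<1}" for f b
    proof -
      have "ennreal (norm (f (\<gamma> b) - f (\<gamma> 0)))
        \<le> (\<integral>\<^sup>+ t\<in>{0..b}. ennreal (norm (deriv f (\<gamma> t) * vector_derivative \<gamma> (at t))) \<partial>lborel)"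
        using b \<gamma> \<gamma>S by (intro norm_increment_le_nn_integral[OF open_S hol[OF f]])
          (auto simp: divergent_path_def)
      also have "\<dots> \<le> path_metric_length X \<gamma>"
        unfolding path_metric_length_def
      proof (intro nn_integral_mono)
        fix t :: real
        show "ennreal (norm (deriv f (\<gamma> t) * vector_derivative \<gamma> (at t))) * indicator {0..b} t
          \<le> ennreal (sqrt (induced_metric X (\<gamma> t) (vector_derivative \<gamma> (at t)) (vector_derivative \<gamma> (at t))))
             * indicator {0..<1} t"
        proof (cases "t \<in> {0..b}")
          case True
          with b have t: "t \<in> {0..<1}" by auto
          have "norm (deriv f (\<gamma> t) * vector_derivative \<gamma> (at t))
            \<le> sqrt (\<rho> (\<gamma> t)) * norm (vector_derivative \<gamma> (at t))"
            unfolding norm_mult using deriv_le[OF f \<gamma>S[OF t]] by (intro mult_right_mono) auto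
          then show ?thesis
            using True t by (simp add: induced_metric_eq[OF \<gamma>S[OF t]] real_sqrt_mult
                norm_eq_sqrt_inner ennreal_leI)
        qed auto
      qed
      finally show ?thesis
        using l by simp
    qed
    define M where "M = Max ((\<lambda>f. norm (f (\<gamma> 0))) ` \<F>) + l"
    obtain K where K: "compact K" "K \<subseteq> S" "{z \<in> S. \<forall>f\<in>\<F>. norm (f z) \<le> M} \<subseteq> K"
      using proper by blast
    obtain t\<^sub>0 where t\<^sub>0: "t\<^sub>0 \<in> {0..<1}" "\<And>t. t \<in> {t\<^sub>0..<1} \<Longrightarrow> \<gamma> t \<notin> K"
      using \<gamma> K by (auto simp: divergent_path_def)
    define t where "t = (t\<^sub>0 + 1) / 2"
    have t: "t \<in> {0<..<1}" "t \<in> {t\<^sub>0..<1}" "t \<in> {0..<1}"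
      using t\<^sub>0(1) by (auto simp: t_def)
    have "norm (f (\<gamma> t)) \<le> M" if f: "f \<in> \<F>" for f
    proof -
      have "norm (f (\<gamma> 0)) \<le> Max ((\<lambda>f. norm (f (\<gamma> 0))) ` \<F>)"
        using f assms(1) by simp
      then show ?thesis
        using incr[OF f t(1)] norm_triangle_ineq2[of "f (\<gamma> t)" "f (\<gamma> 0)"] by (simp add: M_def)
    qed
    then show False
      using K(3) \<gamma>S[OF t(3)] t\<^sub>0(2)[OF t(2)] by blast
  qed
  then show ?thesis
    by (auto simp: complete_surface_on_def)
qed

section \<open>Ramification of fractional linear functions of the square\<close>

lemma exists_totally_ramified_iff:
  "(\<exists>\<nu>. totally_ramified f S \<alpha> \<nu>) \<longleftrightarrow> (\<forall>z\<in>S. sphere_value f z = \<alpha> \<longrightarrow> 2 \<le> root_multiplicity f \<alpha> z)"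
proof
  assume "\<exists>\<nu>. totally_ramified f S \<alpha> \<nu>"
  then obtain \<nu> where "2 \<le> \<nu>" "\<And>z. z \<in> S \<Longrightarrow> sphere_value f z = \<alpha> \<Longrightarrow> \<not> root_multiplicity f \<alpha> z < \<nu>"
    unfolding totally_ramified_def by blast
  then show "\<forall>z\<in>S. sphere_value f z = \<alpha> \<longrightarrow> 2 \<le> root_multiplicity f \<alpha> z"
    by (meson not_less order_trans)
next
  assume "\<forall>z\<in>S. sphere_value f z = \<alpha> \<longrightarrow> 2 \<le> root_multiplicity f \<alpha> z"
  then have "totally_ramified f S \<alpha> 2"
    unfolding totally_ramified_def not_less[symmetric] by blast
  then show "\<exists>\<nu>. totally_ramified f S \<alpha> \<nu>" ..
qed

(* Unfolding multiplicities into orders of zeros would hide the evaluated multiplicities below. *)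
declare root_multiplicity.simps [simp del]

definition twice_punctured_plane :: "complex set" where
  "twice_punctured_plane = {z. z\<^sup>2 \<noteq> - 1}"

text \<open>For \<open>a = -1\<close> the function would be constant.\<close>

locale even_quadratic_map =
  fixes a :: complex and g :: "complex \<Rightarrow> complex"
  assumes a: "a \<noteq> -1"
  defines "g \<equiv> \<lambda>z. (z\<^sup>2 + a) / (z\<^sup>2 - 1)"
begin

lemma a_plus_1: "a + 1 \<noteq> 0" "1 + a \<noteq> 0" "- a \<noteq> 1" "- a - 1 \<noteq> 0"
proof -
  show *: "a + 1 \<noteq> 0"
    using a by (simp add: add_eq_0_iff2)
  show "1 + a \<noteq> 0"
    using * by (simp only: add.commute not_False_eq_True)
  show "- a \<noteq> 1"
    using a by (metis minus_minus)
  then show "- a - 1 \<noteq> 0"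
    by simp
qed

lemma analytic_off_poles:
  assumes "z\<^sup>2 \<noteq> 1"
  shows "g analytic_on {z}"
  unfolding g_def using assms by (auto intro!: analytic_intros)

lemma zorder_pole:
  assumes "z\<^sup>2 = 1"
  shows "zorder g z = -1"
proof (rule zorder_eqI)
  show "open (- {- z})" by auto
  show "z \<in> - {- z}" using assms by auto
  show "(\<lambda>w. (w\<^sup>2 + a) / (w + z)) holomorphic_on - {- z}"
    by (auto intro!: holomorphic_intros simp: add_eq_0_iff2)
  show "(z\<^sup>2 + a) / (z + z) \<noteq> 0"
    using a_plus_1 assms by auto
  fix w assume w: "w \<in> - {- z}" "w \<noteq> z"
  have "w\<^sup>2 - 1 = (w - z) * (w + z)"
    using assms by (simp add: algebra_simps power2_eq_square)
  then show "g w = (w\<^sup>2 + a) / (w + z) * (w - z) powi (- 1)"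
    by (simp add: g_def power_int_minus field_simps)
qed

lemma pole:
  assumes "z\<^sup>2 = 1"
  shows "is_pole g z"
proof -
  have ne: "z\<^sup>2 + a \<noteq> 0" using assms a_plus_1 by simp
  have "filterlim (\<lambda>w. w\<^sup>2 - 1) (at 0) (at z)"
  proof (rule filterlim_atI)
    show "((\<lambda>w. w\<^sup>2 - 1) \<longlongrightarrow> 0) (at z)" using assms by (auto intro!: tendsto_eq_intros)
    show "\<forall>\<^sub>F w in at z. w\<^sup>2 - 1 \<noteq> 0"
      using eventually_neq_at_within[of z z] eventually_neq_at_within[of "- z" z]
      by eventually_elim (metis assms eq_iff_diff_eq_0 power2_eq_iff)
  qed
  then show ?thesis
    unfolding is_pole_def g_def using ne
    by (intro filterlim_divide_at_infinity[where c = "z\<^sup>2 + a"] tendsto_intros)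
qed

lemma sphere_value_pole: "z\<^sup>2 = 1 \<Longrightarrow> sphere_value g z = Infty"
  by (simp add: sphere_value_def pole)

lemma sphere_value_off_poles:
  assumes "z\<^sup>2 \<noteq> 1"
  shows "sphere_value g z = Fin (g z)"
  using analytic_off_poles[OF assms] by (simp add: sphere_value_def analytic_at_imp_no_pole)

lemma root_multiplicity_pole: "z\<^sup>2 = 1 \<Longrightarrow> root_multiplicity g Infty z = 1"
  by (simp add: root_multiplicity.simps zorder_pole one_enat_def)

text \<open>
  This factorization shows all multiplicities: the factor next to \<open>w - z\<close> is nonzero at \<open>w = z\<close> unless
  \<open>z = 0\<close>, where it supplies a second factor \<open>w\<close>.
\<close>

lemma diff_values:
  assumes "z\<^sup>2 \<noteq> 1" "w\<^sup>2 \<noteq> 1"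
  shows "g w - g z = - (a + 1) * (w + z) / ((w\<^sup>2 - 1) * (z\<^sup>2 - 1)) * (w - z)"
proof -
  have frac: "(p + c) / p - (q + c) / q = c * (q - p) / (p * q)" if "p \<noteq> 0" "q \<noteq> 0" for p q c :: complex
    using that by (simp add: field_simps)
  have "g w - g z = (a + 1) * (z\<^sup>2 - w\<^sup>2) / ((w\<^sup>2 - 1) * (z\<^sup>2 - 1))"
    using frac[of "w\<^sup>2 - 1" "z\<^sup>2 - 1" "a + 1"] assms by (simp add: g_def algebra_simps)
  also have "(a + 1) * (z\<^sup>2 - w\<^sup>2) = - (a + 1) * (w + z) * (w - z)"
    by (simp add: algebra_simps power2_eq_square)
  finally show ?thesis
    by (simp only: times_divide_eq_left)
qed

lemma root_multiplicity_off_poles: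
  assumes z: "z\<^sup>2 \<noteq> 1"
  shows "root_multiplicity g (Fin (g z)) z = (if z = 0 then 2 else 1)"
proof -
  let ?U = "{w :: complex. w\<^sup>2 \<noteq> 1}"
  have U: "open ?U"
    by (intro open_Collect_neq continuous_intros)
  have "\<not> (\<forall>\<^sub>F w in at z. g w = g z)"
  proof
    assume "\<forall>\<^sub>F w in at z. g w = g z"
    moreover have "\<forall>\<^sub>F w in at z. w \<in> ?U"
      using U z by (intro eventually_at_in_open') auto
    moreover have "\<forall>\<^sub>F w in at z. w \<noteq> z" "\<forall>\<^sub>F w in at z. w \<noteq> - z"
      by (rule eventually_neq_at_within)+
    ultimately have "\<forall>\<^sub>F w in at z. False"
    proof eventually_elim
      case (elim w)
      then show ?case
        using diff_values[OF z, of w] a_plus_1 z by (auto simp: add_eq_0_iff2)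
    qed
    then show False by simp
  qed
  moreover have "zorder (\<lambda>w. g w - g z) z = (if z = 0 then 2 else 1)"
  proof (cases "z = 0")
    case True
    have "zorder (\<lambda>w. g w - g z) z = 2"
    proof (rule zorder_eqI[OF U])
      show "(\<lambda>w. (a + 1) / (w\<^sup>2 - 1)) holomorphic_on ?U"
        by (auto intro!: holomorphic_intros)
      show "g w - g z = (a + 1) / (w\<^sup>2 - 1) * (w - z) powi 2" if "w \<in> ?U" for w
        using that True by (simp add: g_def divide_simps) (simp add: algebra_simps)
    qed (use z a_plus_1 in auto)
    then show ?thesis using True by simp
  next
    case False
    have "zorder (\<lambda>w. g w - g z) z = 1"
    proof (rule zorder_eqI[OF U])
      show "(\<lambda>w. - (a + 1) * (w + z) / ((w\<^sup>2 - 1) * (z\<^sup>2 - 1))) holomorphic_on ?U"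
        using z by (auto intro!: holomorphic_intros)
      show "g w - g z = - (a + 1) * (w + z) / ((w\<^sup>2 - 1) * (z\<^sup>2 - 1)) * (w - z) powi 1" if "w \<in> ?U" for w
        using diff_values[OF z, of w] that by simp
      show "- (a + 1) * (z + z) / ((z\<^sup>2 - 1) * (z\<^sup>2 - 1)) \<noteq> 0"
        using z a_plus_1 False by simp
    qed (use z in auto)
    then show ?thesis using False by simp
  qed
  ultimately show ?thesis
    by (simp add: root_multiplicity.simps numeral_eq_enat one_enat_def)
qed

text \<open>
  Solving \<open>g z = \<beta>\<close> for \<open>z\<^sup>2\<close>: every value other than 1 (taken at \<open>\<infinity>\<close> in the sphere) has a finite
  preimage.
\<close>

lemma value_eq_iff:
  assumes "z\<^sup>2 \<noteq> 1"
  shows "g z = \<beta> \<longleftrightarrow> z\<^sup>2 * (\<beta> - 1) = a + \<beta>"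
proof -
  have "z\<^sup>2 * (\<beta> - 1) - (a + \<beta>) = \<beta> * (z\<^sup>2 - 1) - (z\<^sup>2 + a)"
    by (simp add: algebra_simps)
  then have "z\<^sup>2 * (\<beta> - 1) = a + \<beta> \<longleftrightarrow> z\<^sup>2 + a = \<beta> * (z\<^sup>2 - 1)"
    by (metis eq_iff_diff_eq_0)
  then show ?thesis
    using assms by (simp add: g_def divide_eq_eq)
qed

lemma not_value_1: "z\<^sup>2 \<noteq> 1 \<Longrightarrow> g z \<noteq> 1"
  using value_eq_iff[of z 1] a_plus_1 by simp

lemma value_0: "g 0 = - a"
  by (simp add: g_def)

lemma value_neg_a_iff:
  assumes "z\<^sup>2 \<noteq> 1"
  shows "g z = - a \<longleftrightarrow> z = 0"
proof -
  show ?thesis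
    using value_eq_iff[OF assms, of "- a"] a_plus_1 by simp
qed

lemma value_puncture_iff:
  assumes "z\<^sup>2 \<noteq> 1"
  shows "g z = (1 - a) / 2 \<longleftrightarrow> z\<^sup>2 = - 1"
proof -
  have "g z = (1 - a) / 2 \<longleftrightarrow> z\<^sup>2 * (- (1 + a) / 2) = (1 + a) / 2"
    unfolding value_eq_iff[OF assms] by (simp add: field_simps)
  also have "\<dots> \<longleftrightarrow> (z\<^sup>2 + 1) * (1 + a) = 0"
  proof -
    have "(z\<^sup>2 + 1) * (1 + a) = - 2 * (z\<^sup>2 * (- (1 + a) / 2) - (1 + a) / 2)"
      by (simp add: field_simps)
    then show ?thesis
      unfolding mult_eq_0_iff eq_iff_diff_eq_0[symmetric] by (metis eq_iff_diff_eq_0 mult_eq_0_iff neg_equal_0_iff_equal zero_neq_numeral)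
  qed
  also have "\<dots> \<longleftrightarrow> z\<^sup>2 = - 1"
    using a_plus_1 by (simp add: eq_neg_iff_add_eq_0)
  finally show ?thesis .
qed

abbreviation "S \<equiv> twice_punctured_plane"

text \<open>
  Any other value has a simple root: a pole at \<open>1\<close> for the value \<open>\<infinity>\<close>, and otherwise a square root of
  the unique solution for \<open>z\<^sup>2\<close>, which is neither \<open>0\<close> nor \<open>-1\<close>.
\<close>

lemma totally_ramified_values:
  "{\<alpha>. \<exists>\<nu>. totally_ramified g S \<alpha> \<nu>} = {Fin 1, Fin ((1 - a) / 2), Fin (- a)}"
proof (intro equalityI subsetI)
  fix \<alpha> assume "\<alpha> \<in> {\<alpha>. \<exists>\<nu>. totally_ramified g S \<alpha> \<nu>}"
  then have *: "2 \<le> root_multiplicity g \<alpha> z" if "z \<in> S" "sphere_value g z = \<alpha>" for z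
    using that exists_totally_ramified_iff by blast
  have not2: "\<not> (2 :: enat) \<le> 1"
    by (simp add: numeral_eq_enat one_enat_def)
  show "\<alpha> \<in> {Fin 1, Fin ((1 - a) / 2), Fin (- a)}"
  proof (cases \<alpha>)
    case Infty
    have "2 \<le> root_multiplicity g \<alpha> 1"
      by (rule *) (simp_all add: twice_punctured_plane_def sphere_value_pole Infty)
    then show ?thesis
      using not2 by (simp add: root_multiplicity_pole Infty)
  next
    case (Fin \<beta>)
    have False if \<beta>: "\<beta> \<noteq> 1" "\<beta> \<noteq> (1 - a) / 2" "\<beta> \<noteq> - a"
    proof -
      define z where "z = csqrt ((a + \<beta>) / (\<beta> - 1))"
      have "z\<^sup>2 = (a + \<beta>) / (\<beta> - 1)"
        unfolding z_def by (rule power2_csqrt)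
      then have z2: "z\<^sup>2 * (\<beta> - 1) = a + \<beta>"
        using \<beta>(1) by simp
      then have "a + 1 = (z\<^sup>2 - 1) * (\<beta> - 1)"
        by (simp add: algebra_simps)
      then have z: "z\<^sup>2 \<noteq> 1"
        using a_plus_1 by auto
      have gz: "g z = \<beta>"
        using value_eq_iff[OF z] z2 by simp
      then have "z \<in> S" "z \<noteq> 0"
        using \<beta> value_puncture_iff[OF z] value_0 by (auto simp: twice_punctured_plane_def)
      then have "2 \<le> root_multiplicity g (Fin (g z)) z"
        using sphere_value_off_poles[OF z] gz Fin by (intro *[unfolded Fin, folded gz]) auto
      then show False
        using not2 \<open>z \<noteq> 0\<close> by (simp add: root_multiplicity_off_poles[OF z])
    qed
    then show ?thesis using Fin by blast
  qed
next
  fix \<alpha> assume "\<alpha> \<in> {Fin 1, Fin ((1 - a) / 2), Fin (- a)}"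
  moreover have "2 \<le> root_multiplicity g \<alpha> z"
    if "z \<in> S" "sphere_value g z = \<alpha>" "\<alpha> \<in> {Fin 1, Fin ((1 - a) / 2), Fin (- a)}" for z
  proof -
    have z: "z\<^sup>2 \<noteq> 1"
      using that sphere_value_pole[of z] by auto
    then have "z = 0" "\<alpha> = Fin (g z)"
      using that not_value_1[OF z] value_puncture_iff[OF z] value_neg_a_iff[OF z]
      by (auto simp: sphere_value_off_poles twice_punctured_plane_def)
    then show ?thesis
      using root_multiplicity_off_poles[OF z] by simp
  qed
  ultimately show "\<alpha> \<in> {\<alpha>. \<exists>\<nu>. totally_ramified g S \<alpha> \<nu>}"
    by (auto simp: exists_totally_ramified_iff)
qed

lemma roots:
  "{z \<in> S. sphere_value g z = Fin 1} = {}"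
  "{z \<in> S. sphere_value g z = Fin ((1 - a) / 2)} = {}"
  "{z \<in> S. sphere_value g z = Fin (- a)} = {0}"
proof -
  have *: "sphere_value g z = Fin \<beta> \<longleftrightarrow> z\<^sup>2 \<noteq> 1 \<and> g z = \<beta>" for z \<beta>
    by (cases "z\<^sup>2 = 1") (auto simp: sphere_value_off_poles sphere_value_pole)
  show "{z \<in> S. sphere_value g z = Fin 1} = {}"
    "{z \<in> S. sphere_value g z = Fin ((1 - a) / 2)} = {}"
    "{z \<in> S. sphere_value g z = Fin (- a)} = {0}"
    using not_value_1 value_puncture_iff value_neg_a_iff value_0 by (auto simp: * twice_punctured_plane_def)
qed

lemma total_weight: "total_weight g S = 5 / 2"
proof -
  have ne: "1 \<noteq> (1 - a) / 2" "(1 - a) / 2 \<noteq> - a" "1 \<noteq> - a"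
  proof -
    have h: "2 * ((1 - a) / 2) = 1 - a"
      by simp
    have "a + 1 = 2 * (1 - (1 - a) / 2)" "a + 1 = 2 * ((1 - a) / 2 - - a)"
      using h by (simp_all only: right_diff_distrib) simp_all
    then show "1 \<noteq> (1 - a) / 2" "(1 - a) / 2 \<noteq> - a"
      using a_plus_1(1) by (metis diff_self mult_zero_right)+
    show "1 \<noteq> - a"
      using a_plus_1(3) by (rule not_sym)
  qed
  have "ramification_order g S (Fin (- a)) = 2"
    using root_multiplicity_off_poles[of 0] by (simp add: ramification_order_def roots value_0)
  then have w: "weight (ramification_order g S (Fin 1)) = 1"
    "weight (ramification_order g S (Fin ((1 - a) / 2))) = 1"
    "weight (ramification_order g S (Fin (- a))) = 1 / 2"
    by (simp_all add: ramification_order_def roots weight_def top_enat_def numeral_eq_enat)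
  have sum3: "sum f {x, y, z} = f x + f y + f z" if "x \<noteq> y" "y \<noteq> z" "x \<noteq> z"
    for f :: "riemann_sphere \<Rightarrow> real" and x y z
    using that by simp
  have "Fin 1 \<noteq> Fin ((1 - a) / 2)" "Fin ((1 - a) / 2) \<noteq> Fin (- a)" "Fin 1 \<noteq> Fin (- a)"
    using ne by (simp_all only: riemann_sphere.inject not_False_eq_True)
  note sum3 = sum3[OF this]
  show ?thesis
    unfolding total_weight_def totally_ramified_values sum3 w by simp
qed

end

section \<open>Logarithmic primitives\<close>

lemma has_derivative_ln_norm:
  fixes p z :: complex
  assumes "z \<noteq> p"
  shows "((\<lambda>w. ln (norm (w - p))) has_derivative (\<lambda>v. Re (1 / (z - p) * v))) (at z)"
proof -
  have "((\<lambda>w. norm (w - p)) has_derivative (\<lambda>v. inner v (sgn (z - p)))) (at z)"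
    using assms by (intro has_derivative_eq_rhs[OF has_derivative_compose[OF _ has_derivative_norm], of "\<lambda>w. w - p"])
      (auto intro!: derivative_eq_intros)
  then have "((\<lambda>w. ln (norm (w - p))) has_derivative (\<lambda>v. inner v (sgn (z - p)) * inverse (norm (z - p)))) (at z)"
    using assms by (intro has_derivative_ln) auto
  moreover have "inner v (sgn u) * inverse (norm u) = Re (1 / u * v)" for u v :: complex
    by (simp add: sgn_div_norm inner_complex_def Re_divide cmod_power2[symmetric])
      (simp add: divide_inverse algebra_simps power2_eq_square)
  ultimately show ?thesis
    by simp
qed

text \<open>
  The integral itself depends on how the path winds around \<open>p\<close>, but its exponential is the quotient of
  the end points, and taking the modulus leaves the real part.
\<close>

lemma Re_contour_integral_inverse_diff:
  assumes "valid_path \<gamma>" "p \<notin> path_image \<gamma>"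
  shows "Re (contour_integral \<gamma> (\<lambda>w. 1 / (w - p)))
    = ln (norm (pathfinish \<gamma> - p)) - ln (norm (pathstart \<gamma> - p))"
proof -
  have eq: "pathfinish \<gamma> - p = exp (contour_integral \<gamma> (\<lambda>w. 1 / (w - p))) * (pathstart \<gamma> - p)"
    using winding_number_exp_2pi[OF valid_path_imp_path[OF assms(1)] assms(2)]
      winding_number_valid_path[OF assms] by simp
  have "pathstart \<gamma> - p \<noteq> 0"
    using assms(2) by auto
  then show ?thesis
    unfolding eq by (simp add: norm_mult ln_mult)
qed

section \<open>The isotropic curve of Weierstrass data without poles\<close>

lemma norm_diff_square_le:
  fixes x y :: "'a::real_normed_vector"
  shows "(norm (x - y))\<^sup>2 \<le> 2 * ((norm x)\<^sup>2 + (norm y)\<^sup>2)"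
proof -
  have "(norm (x - y))\<^sup>2 \<le> (norm x + norm y)\<^sup>2"
    by (intro power_mono norm_triangle_ineq4) simp
  also have "\<dots> \<le> 2 * ((norm x)\<^sup>2 + (norm y)\<^sup>2)"
    using sum_squares_bound[of "norm x" "norm y"] by (simp add: power2_sum)
  finally show ?thesis .
qed

text \<open>
  Twice the Weierstrass forms for \<open>g\<^sub>1 = t\<^sub>1 / s\<close>, \<open>g\<^sub>2 = t\<^sub>2 / s\<close>, \<open>h = s\<^sup>2\<close>. Clearing the denominators
  removes the poles of the Gauss map.
\<close>

definition null_curve ::
  "(complex \<Rightarrow> complex) \<Rightarrow> (complex \<Rightarrow> complex) \<Rightarrow> (complex \<Rightarrow> complex) \<Rightarrow> 4 \<Rightarrow> complex \<Rightarrow> complex" where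
  "null_curve s t\<^sub>1 t\<^sub>2 k z =
    (if k = 1 then (s z)\<^sup>2 + t\<^sub>1 z * t\<^sub>2 z
     else if k = 2 then \<i> * ((s z)\<^sup>2 - t\<^sub>1 z * t\<^sub>2 z)
     else if k = 3 then s z * (t\<^sub>1 z - t\<^sub>2 z)
     else - \<i> * (s z * (t\<^sub>1 z + t\<^sub>2 z)))"

lemma null_curve_isotropic: "(\<Sum>k\<in>UNIV. (null_curve s t\<^sub>1 t\<^sub>2 k z)\<^sup>2) = 0"
  by (simp add: sum_4 null_curve_def power_mult_distrib) (simp add: algebra_simps power2_eq_square)

text \<open>The parallelogram law, applied to the first two and to the last two components.\<close>

lemma null_curve_norm:
  "(\<Sum>k\<in>UNIV. (norm (null_curve s t\<^sub>1 t\<^sub>2 k z))\<^sup>2) / 2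
    = ((norm (s z))\<^sup>2 + (norm (t\<^sub>1 z))\<^sup>2) * ((norm (s z))\<^sup>2 + (norm (t\<^sub>2 z))\<^sup>2)"
proof -
  have par: "(norm (x + y))\<^sup>2 + (norm (x - y))\<^sup>2 = 2 * (norm x)\<^sup>2 + 2 * (norm y)\<^sup>2" for x y :: complex
    by (simp only: cmod_power2) (simp add: power2_eq_square algebra_simps)
  have 4: "norm (null_curve s t\<^sub>1 t\<^sub>2 4 z) = norm (s z) * norm (t\<^sub>1 z + t\<^sub>2 z)"
    by (simp add: null_curve_def norm_mult del: mult_minus_left mult_minus_right)
  have "(\<Sum>k\<in>UNIV. (norm (null_curve s t\<^sub>1 t\<^sub>2 k z))\<^sup>2)
    = ((norm ((s z)\<^sup>2 + t\<^sub>1 z * t\<^sub>2 z))\<^sup>2 + (norm ((s z)\<^sup>2 - t\<^sub>1 z * t\<^sub>2 z))\<^sup>2)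
      + (norm (s z))\<^sup>2 * ((norm (t\<^sub>1 z + t\<^sub>2 z))\<^sup>2 + (norm (t\<^sub>1 z - t\<^sub>2 z))\<^sup>2)"
    unfolding sum_4 4 by (simp add: null_curve_def norm_mult power_mult_distrib distrib_left)
  then show ?thesis
    unfolding par by (simp add: norm_mult norm_power algebra_simps power2_eq_square)
qed

text \<open>
  Agreement on a punctured neighbourhood suffices, since removing singularities sees only the limit.
  This covers the zeros of \<open>s\<close>, where the quotients are meaningless.
\<close>

lemma weierstrass_form_eq_null_curve:
  assumes F: "\<And>k. null_curve s t\<^sub>1 t\<^sub>2 k analytic_on {z}"
    and ev: "\<forall>\<^sub>F w in at z. s w \<noteq> 0 \<and> g\<^sub>1 w = t\<^sub>1 w / s w \<and> g\<^sub>2 w = t\<^sub>2 w / s w \<and> h w = (s w)\<^sup>2"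
  shows "2 * weierstrass_form g\<^sub>1 g\<^sub>2 h k z = null_curve s t\<^sub>1 t\<^sub>2 k z"
proof -
  have "weierstrass_form g\<^sub>1 g\<^sub>2 h k z = remove_sings (\<lambda>w. null_curve s t\<^sub>1 t\<^sub>2 k w / 2) z"
    unfolding weierstrass_form_def
  proof (rule remove_sings_cong[OF _ refl], use ev in eventually_elim)
    case (elim w)
    then show ?case
      by (simp add: null_curve_def power2_eq_square) (simp add: field_simps)
  qed
  also have "\<dots> = null_curve s t\<^sub>1 t\<^sub>2 k z / 2"
    using F by (intro remove_sings_at_analytic analytic_intros) auto
  finally show ?thesis by (simp only: mult.commute) simp
qed

section \<open>Integrability of the curvature density\<close>

text \<open>
  Let \<open>r = |z|\<^sup>2\<close> and let \<open>D\<close> be the denominator before squaring. The two polynomials differ by the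
  constant \<open>d + 1\<close>, hence \<open>D \<ge> m\<close> with \<open>m = (d + 1)\<^sup>2 / 2\<close>; moreover \<open>D \<ge> (r - 1)\<^sup>2\<close>. The first bound is
  used for \<open>r \<le> 3\<close> and the second for \<open>r > 3\<close>, which gives \<open>r (1 + r)\<^sup>2 \<le> C D\<^sup>2\<close>. A product of functions of
  \<open>Re z\<close> and \<open>Im z\<close> is chosen as the majorant because its integral factors.
\<close>

lemma density_bound:
  assumes d: "d + 1 \<noteq> (0::real)"
  obtains C where "C \<ge> 0" "\<And>z. (norm z)\<^sup>2 / ((norm (z\<^sup>2 - 1))\<^sup>2 + (norm (z\<^sup>2 + of_real d))\<^sup>2)\<^sup>2
    \<le> C * (inverse (1 + (Re z)\<^sup>2) * inverse (1 + (Im z)\<^sup>2))"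
    "\<And>z::complex. (norm (z\<^sup>2 - 1))\<^sup>2 + (norm (z\<^sup>2 + of_real d))\<^sup>2 > 0"
proof
  define m where "m = (d + 1)\<^sup>2 / 2"
  have m: "m > 0" using d by (simp add: m_def)
  \<comment> \<open>\<open>48 = 3 \<cdot> 4\<^sup>2\<close> bounds \<open>r (1 + r)\<^sup>2\<close> for \<open>r \<le> 3\<close>; for \<open>r > 3\<close> it is at most \<open>8 (r - 1)\<^sup>4\<close>.\<close>
  define C where "C = 48 / m\<^sup>2 + 8"
  show "C \<ge> 0" by (simp add: C_def)
  fix z :: complex
  let ?D = "(norm (z\<^sup>2 - 1))\<^sup>2 + (norm (z\<^sup>2 + of_real d))\<^sup>2"
  define r where "r = (norm z)\<^sup>2"
  have r: "r \<ge> 0" by (simp add: r_def)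
  have "(z\<^sup>2 + of_real d) - (z\<^sup>2 - 1) = of_real (d + 1)"
    by simp
  then have "(d + 1)\<^sup>2 = (norm ((z\<^sup>2 + of_real d) - (z\<^sup>2 - 1)))\<^sup>2"
    by (metis norm_of_real power2_abs)
  also have "\<dots> \<le> 2 * ?D"
    using norm_diff_square_le[of "z\<^sup>2 + of_real d" "z\<^sup>2 - 1"] by (simp only: add.commute)
  finally have Dm: "m \<le> ?D"
    by (simp add: m_def)
  then show D: "?D > 0" using m by linarith
  have "r * (1 + r)\<^sup>2 \<le> C * ?D\<^sup>2"
  proof (cases "r \<le> 3")
    case True
    have "r * (1 + r)\<^sup>2 \<le> 3 * 4\<^sup>2"
      using True r by (intro mult_mono power_mono) auto
    also have "\<dots> = 48 / m\<^sup>2 * m\<^sup>2"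
      using m by simp
    also have "\<dots> \<le> C * ?D\<^sup>2"
      using Dm m by (intro mult_mono power_mono) (auto simp: C_def)
    finally show ?thesis .
  next
    case False
    have "r - 1 \<le> norm (z\<^sup>2 - 1)"
      using norm_triangle_ineq2[of "z\<^sup>2" 1] by (simp add: r_def norm_power)
    then have "(r - 1)\<^sup>2 \<le> (norm (z\<^sup>2 - 1))\<^sup>2"
      using False by (intro power_mono) auto
    then have "(r - 1)\<^sup>2 \<le> ?D"
      by (simp add: add_increasing2)
    then have D4: "((r - 1)\<^sup>2)\<^sup>2 \<le> ?D\<^sup>2"
      by (intro power_mono) auto
    have "r * (1 + r)\<^sup>2 \<le> (2 * (r - 1)\<^sup>2) * (2 * (r - 1))\<^sup>2"
    proof (intro mult_mono power_mono)
      have "1 * (r - 1) \<le> (r - 1) * (r - 1)"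
        using False by (intro mult_right_mono) auto
      then have "r - 1 \<le> (r - 1)\<^sup>2"
        by (simp only: power2_eq_square mult_1)
      then show "r \<le> 2 * (r - 1)\<^sup>2"
        using False by linarith
    qed (use False in auto)
    also have "\<dots> = 8 * ((r - 1)\<^sup>2)\<^sup>2"
    proof -
      have "(2 * x\<^sup>2) * (2 * x)\<^sup>2 = 8 * (x\<^sup>2)\<^sup>2" for x :: real
        by (simp add: power2_eq_square)
      then show ?thesis .
    qed
    also have "\<dots> \<le> C * ?D\<^sup>2"
      using D4 by (intro mult_mono) (auto simp: C_def)
    finally show ?thesis .
  qed
  moreover have "(1 + (Re z)\<^sup>2) * (1 + (Im z)\<^sup>2) \<le> (1 + r)\<^sup>2"
    unfolding power2_eq_square[of "1 + r"] by (intro mult_mono) (auto simp: r_def cmod_power2)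
  then have "r * ((1 + (Re z)\<^sup>2) * (1 + (Im z)\<^sup>2)) \<le> r * (1 + r)\<^sup>2"
    using r by (rule mult_left_mono)
  ultimately have le: "r * ((1 + (Re z)\<^sup>2) * (1 + (Im z)\<^sup>2)) \<le> C * ?D\<^sup>2"
    by linarith
  have divide: "x / D \<le> C * (inverse u * inverse v)"
    if "x * (u * v) \<le> C * D" "u > 0" "v > 0" "D > 0" for x u v D :: real
    using that by (simp add: field_simps)
  show "(norm z)\<^sup>2 / ?D\<^sup>2 \<le> C * (inverse (1 + (Re z)\<^sup>2) * inverse (1 + (Im z)\<^sup>2))"
    unfolding r_def[symmetric] using D by (intro divide le) (auto intro: add_pos_nonneg)
qed

lemma integrable_complex_product:
  fixes f g :: "real \<Rightarrow> real"
  assumes f: "integrable lborel f" "\<And>x. 0 \<le> f x" and g: "integrable lborel g" "\<And>x. 0 \<le> g x"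
  shows "integrable lborel (\<lambda>z. f (Re z) * g (Im z))"
proof (rule integrableI_bounded)
  have [measurable]: "f \<in> borel_measurable borel" "g \<in> borel_measurable borel"
    using f(1) g(1) borel_measurable_integrable by force+
  show "(\<lambda>z. f (Re z) * g (Im z)) \<in> borel_measurable lborel"
    by measurable
  define F where "F b = (if b = 1 then f else g)" for b :: complex
  have "(\<integral>\<^sup>+ z. (\<Prod>b\<in>Basis. ennreal (F b (z \<bullet> b))) \<partial>lborel) = (\<Prod>b\<in>Basis. \<integral>\<^sup>+ x. ennreal (F b x) \<partial>lborel)"
    by (rule nn_integral_lborel_prod) (auto simp: F_def)
  moreover have "\<i> \<noteq> 1" by (simp add: complex_eq_iff)
  ultimately have "(\<integral>\<^sup>+ z. ennreal (f (Re z)) * ennreal (g (Im z)) \<partial>lborel)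
      = (\<integral>\<^sup>+ x. ennreal (f x) \<partial>lborel) * (\<integral>\<^sup>+ x. ennreal (g x) \<partial>lborel)"
    by (simp add: Basis_complex_def F_def inner_complex_def)
  also have "\<dots> < \<infinity>"
    using f g by (simp add: ennreal_mult_less_top nn_integral_eq_integral)
  finally show "(\<integral>\<^sup>+ z. ennreal (norm (f (Re z) * g (Im z))) \<partial>lborel) < \<infinity>"
    using f g by (simp add: ennreal_mult)
qed

lemma integrable_density_term:
  assumes d: "d + 1 \<noteq> (0::real)"
  shows "integrable lborel (\<lambda>z::complex. (norm z)\<^sup>2 / ((norm (z\<^sup>2 - 1))\<^sup>2 + (norm (z\<^sup>2 + of_real d))\<^sup>2)\<^sup>2)"
proof -
  obtain C where C: "C \<ge> 0" "\<And>z. (norm z)\<^sup>2 / ((norm (z\<^sup>2 - 1))\<^sup>2 + (norm (z\<^sup>2 + of_real d))\<^sup>2)\<^sup>2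
    \<le> C * (inverse (1 + (Re z)\<^sup>2) * inverse (1 + (Im z)\<^sup>2))"
    "\<And>z::complex. (norm (z\<^sup>2 - 1))\<^sup>2 + (norm (z\<^sup>2 + of_real d))\<^sup>2 > 0"
    using density_bound[OF d] by blast
  have "integrable lborel (\<lambda>x::real. inverse (1 + x\<^sup>2))"
    using integrable_inverse_1_plus_square by (simp add: set_integrable_def einterval_eq_UNIV)
  then have "integrable lborel (\<lambda>z. C * (inverse (1 + (Re z)\<^sup>2) * inverse (1 + (Im z)\<^sup>2)))"
    by (intro integrable_mult_right integrable_complex_product) auto
  then show ?thesis
  proof (rule Bochner_Integration.integrable_bound)
    have "continuous_on UNIV (\<lambda>z::complex. (norm z)\<^sup>2 / ((norm (z\<^sup>2 - 1))\<^sup>2 + (norm (z\<^sup>2 + of_real d))\<^sup>2)\<^sup>2)"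
      by (intro continuous_intros ballI) (metis C(3) less_irrefl power_eq_0_iff)
    then show "(\<lambda>z::complex. (norm z)\<^sup>2 / ((norm (z\<^sup>2 - 1))\<^sup>2 + (norm (z\<^sup>2 + of_real d))\<^sup>2)\<^sup>2)
        \<in> borel_measurable lborel"
      by (simp add: borel_measurable_continuous_onI)
    show "AE z in lborel. norm ((norm z)\<^sup>2 / ((norm (z\<^sup>2 - 1))\<^sup>2 + (norm (z\<^sup>2 + of_real d))\<^sup>2)\<^sup>2)
        \<le> norm (C * (inverse (1 + (Re z)\<^sup>2) * inverse (1 + (Im z)\<^sup>2)))"
      using C(1,2) by (simp add: abs_of_nonneg)
  qed
qed

section \<open>The surface\<close>

locale surface_family =
  fixes a b :: real
  assumes ab: "(a + 1) * (b + 1) = 8"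
begin

abbreviation "S \<equiv> twice_punctured_plane"

definition s :: "complex \<Rightarrow> complex" where "s z = (z\<^sup>2 - 1) / (z\<^sup>2 + 1)"
definition t :: "real \<Rightarrow> complex \<Rightarrow> complex" where "t c z = (z\<^sup>2 + of_real c) / (z\<^sup>2 + 1)"

abbreviation "F \<equiv> null_curve s (t a) (t b)"

lemma factor: "z\<^sup>2 + 1 = (z - \<i>) * (z + \<i>)" for z :: complex
  by (simp add: algebra_simps power2_eq_square)

lemma S_iff: "z \<in> S \<longleftrightarrow> z\<^sup>2 + 1 \<noteq> 0" "z \<in> S \<longleftrightarrow> z \<noteq> \<i> \<and> z \<noteq> - \<i>"
proof -
  note factor[of z]
  moreover show *: "z \<in> S \<longleftrightarrow> z\<^sup>2 + 1 \<noteq> 0"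
    by (simp add: twice_punctured_plane_def eq_neg_iff_add_eq_0)
  ultimately show "z \<in> S \<longleftrightarrow> z \<noteq> \<i> \<and> z \<noteq> - \<i>"
    by (simp add: eq_neg_iff_add_eq_0)
qed

lemma S_eq: "S = - {\<i>, - \<i>}"
  using S_iff(2) by auto

lemma open_S: "open S"
  by (simp add: S_eq finite_imp_closed open_Compl)

lemma connected_S: "connected S"
  unfolding S_eq by (intro path_connected_imp_connected path_connected_complement_countable) auto

lemma s_t_holomorphic: "s holomorphic_on S" "t c holomorphic_on S"
  unfolding s_def t_def by (auto intro!: holomorphic_intros simp: S_iff)

lemma F_holomorphic: "F k holomorphic_on S"
  unfolding null_curve_def by (cases "k = 1"; cases "k = 2"; cases "k = 3")
    (auto intro!: holomorphic_intros s_t_holomorphic)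

text \<open>
  The point \<open>z\<close> may be one of the poles \<open>\<plusminus>1\<close> of the Gauss map; only a punctured neighbourhood of it has
  to avoid them.
\<close>

lemma weierstrass_form_eq:
  assumes "z \<in> S"
  shows "2 * weierstrass_form (\<lambda>z. (z\<^sup>2 + of_real a) / (z\<^sup>2 - 1)) (\<lambda>z. (z\<^sup>2 + of_real b) / (z\<^sup>2 - 1))
    (\<lambda>z. (z\<^sup>2 - 1)\<^sup>2 / (z\<^sup>2 + 1)\<^sup>2) k z = F k z"
proof (rule weierstrass_form_eq_null_curve)
  show "F k analytic_on {z}" for k
    using holomorphic_on_imp_analytic_at[OF F_holomorphic open_S assms] .
  have "\<forall>\<^sub>F w in at z. w \<in> S"
    using open_S assms by (rule eventually_at_in_open')
  then show "\<forall>\<^sub>F w in at z. s w \<noteq> 0 \<and> (w\<^sup>2 + of_real a) / (w\<^sup>2 - 1) = t a w / s w \<and>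
      (w\<^sup>2 + of_real b) / (w\<^sup>2 - 1) = t b w / s w \<and> (w\<^sup>2 - 1)\<^sup>2 / (w\<^sup>2 + 1)\<^sup>2 = (s w)\<^sup>2"
    using eventually_neq_at_within[of 1] eventually_neq_at_within[of "- 1"]
  proof eventually_elim
    case (elim w)
    then have "w\<^sup>2 - 1 \<noteq> 0"
      by (simp add: power2_eq_1_iff)
    then show ?case
      using elim by (simp add: S_iff(1) s_def t_def power_divide)
  qed
qed

text \<open>
  The forms decompose as \<open>F k = R k' + c k / (z - \<i>) - c k / (z + \<i>)\<close> with
  \<open>R k = \<alpha> k z + \<beta> k z / (z\<^sup>2 + 1)\<close>. Here \<open>\<alpha> k\<close> is the value of the form at \<open>\<infinity>\<close>, \<open>\<beta> k\<close> belongs to the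
  double poles and \<open>c k\<close> is the residue at \<open>\<i>\<close>. The relation \<open>a b = 7 - a - b\<close> has been used to
  simplify \<open>\<beta>\<close> and \<open>c\<close>.
\<close>

definition \<alpha> :: "4 \<Rightarrow> complex" where
  "\<alpha> k = (if k = 1 then 2 else if k = 4 then - 2 * \<i> else 0)"

definition \<beta> :: "4 \<Rightarrow> complex" where
  "\<beta> k =
    (if k = 1 then 6 - of_real a - of_real b
     else if k = 3 then of_real b - of_real a
     else \<i> * (of_real a + of_real b - 2))"

definition R :: "4 \<Rightarrow> complex \<Rightarrow> complex" where
  "R k z = \<alpha> k * z + \<beta> k * (z / (z\<^sup>2 + 1))"

definition c :: "4 \<Rightarrow> real" where
  "c k = (if k = 2 then - 2 else if k = 4 then 2 else 0)"

text \<open>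
  That the residues \<open>c k\<close> are real constants rests on the relation between \<open>a\<close> and \<open>b\<close>; it enters through
  the polynomial identities \<open>poly\<close> below.
\<close>

lemma R_deriv:
  assumes z: "z \<in> S"
  shows "(R k has_field_derivative (F k z - of_real (c k) * (1 / (z - \<i>)) + of_real (c k) * (1 / (z + \<i>)))) (at z)"
proof -
  have w: "z\<^sup>2 + 1 \<noteq> 0" using z S_iff by blast
  have cc: "(of_real a + 1) * (of_real b + 1) = (8 :: complex)"
    using arg_cong[OF ab, of of_real] by simp
  have log: "1 / (z - \<i>) - 1 / (z + \<i>) = 2 * \<i> / (z\<^sup>2 + 1)"
  proof -
    have "z - \<i> \<noteq> 0" "z + \<i> \<noteq> 0"
      using z by (auto simp: S_iff(2) eq_neg_iff_add_eq_0)
    then show ?thesis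
      unfolding factor by (simp add: diff_frac_eq)
  qed
  have main: "(R k has_field_derivative (F k z - of_real (c k) * (2 * \<i> / (z\<^sup>2 + 1)))) (at z)"
  proof -
    have quot: "((\<lambda>z. z / (z\<^sup>2 + 1)) has_field_derivative (1 - z\<^sup>2) / (z\<^sup>2 + 1)\<^sup>2) (at z)"
      using w by (auto intro!: derivative_eq_intros simp: power2_eq_square)
    have "(R k has_field_derivative (\<alpha> k + \<beta> k * ((1 - z\<^sup>2) / (z\<^sup>2 + 1)\<^sup>2))) (at z)"
      unfolding R_def by (intro DERIV_add DERIV_cmult_Id DERIV_cmult quot)
    moreover have "\<alpha> k + \<beta> k * ((1 - z\<^sup>2) / (z\<^sup>2 + 1)\<^sup>2) = F k z - of_real (c k) * (2 * \<i> / (z\<^sup>2 + 1))"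
    proof -
      have sol: "\<alpha>' + \<beta>' * (u / W\<^sup>2) = N / W\<^sup>2 - c' * (d / W)"
        if "\<alpha>' * W\<^sup>2 + \<beta>' * u = N - c' * d * W" "W \<noteq> 0" for \<alpha>' \<beta>' u N c' d W :: complex
      proof -
        have "\<alpha>' + \<beta>' * (u / W\<^sup>2) = (\<alpha>' * W\<^sup>2 + \<beta>' * u) / W\<^sup>2"
          "N / W\<^sup>2 - c' * (d / W) = (N - c' * d * W) / W\<^sup>2"
          using that(2) by (simp_all add: add_divide_distrib diff_divide_distrib power2_eq_square)
        then show ?thesis using that(1) by simp
      qed
      have prods: "(s z)\<^sup>2 = (z\<^sup>2 - 1)\<^sup>2 / (z\<^sup>2 + 1)\<^sup>2"
        "t a z * t b z = (z\<^sup>2 + of_real a) * (z\<^sup>2 + of_real b) / (z\<^sup>2 + 1)\<^sup>2"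
        "s z * (t a z - t b z) = (z\<^sup>2 - 1) * (of_real a - of_real b) / (z\<^sup>2 + 1)\<^sup>2"
        "s z * (t a z + t b z) = (z\<^sup>2 - 1) * (2 * z\<^sup>2 + of_real a + of_real b) / (z\<^sup>2 + 1)\<^sup>2"
        by (simp_all add: s_def t_def power2_eq_square diff_divide_distrib[symmetric] add_divide_distrib[symmetric] add_ac)
      have F: "F 1 z = ((z\<^sup>2 - 1)\<^sup>2 + (z\<^sup>2 + of_real a) * (z\<^sup>2 + of_real b)) / (z\<^sup>2 + 1)\<^sup>2"
        "F 2 z = \<i> * ((z\<^sup>2 - 1)\<^sup>2 - (z\<^sup>2 + of_real a) * (z\<^sup>2 + of_real b)) / (z\<^sup>2 + 1)\<^sup>2"
        "F 3 z = (z\<^sup>2 - 1) * (of_real a - of_real b) / (z\<^sup>2 + 1)\<^sup>2"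
        "F 4 z = - \<i> * ((z\<^sup>2 - 1) * (2 * z\<^sup>2 + of_real a + of_real b)) / (z\<^sup>2 + 1)\<^sup>2"
        by (simp add: null_curve_def prods add_divide_distrib)
          (simp add: null_curve_def prods diff_divide_distrib right_diff_distrib,
            (simp only: null_curve_def prods, simp)+)
      have vals: "\<alpha> 1 = 2" "\<alpha> 2 = 0" "\<alpha> 3 = 0" "\<alpha> 4 = - 2 * \<i>"
        "\<beta> 1 = 6 - of_real a - of_real b" "\<beta> 2 = \<i> * (of_real a + of_real b - 2)"
        "\<beta> 3 = of_real b - of_real a" "\<beta> 4 = \<i> * (of_real a + of_real b - 2)"
        "of_real (c 1) = (0 :: complex)" "of_real (c 2) = (- 2 :: complex)"
        "of_real (c 3) = (0 :: complex)" "of_real (c 4) = (2 :: complex)"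
        by (simp_all add: \<alpha>_def \<beta>_def c_def)
      \<comment> \<open>The four decompositions multiplied by \<open>(u + 1)\<^sup>2\<close>, where \<open>u = z\<^sup>2\<close> and \<open>j = \<i>\<close>.\<close>
      have poly: "2 * (u + 1)\<^sup>2 + (6 - A - B) * (1 - u) = (u - 1)\<^sup>2 + (u + A) * (u + B) - 0 * (2 * j) * (u + 1)"
        "0 * (u + 1)\<^sup>2 + j * (A + B - 2) * (1 - u) = j * ((u - 1)\<^sup>2 - (u + A) * (u + B)) - (- 2) * (2 * j) * (u + 1)"
        "0 * (u + 1)\<^sup>2 + (B - A) * (1 - u) = (u - 1) * (A - B) - 0 * (2 * j) * (u + 1)"
        "- 2 * j * (u + 1)\<^sup>2 + j * (A + B - 2) * (1 - u) = - j * ((u - 1) * (2 * u + A + B)) - 2 * (2 * j) * (u + 1)"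
        if "(A + 1) * (B + 1) = 8" for A B u j :: complex
      proof -
        have "2 * (u + 1)\<^sup>2 + (6 - A - B) * (1 - u) - ((u - 1)\<^sup>2 + (u + A) * (u + B) - 0 * (2 * j) * (u + 1))
            = 8 - (A + 1) * (B + 1)"
          "0 * (u + 1)\<^sup>2 + j * (A + B - 2) * (1 - u)
            - (j * ((u - 1)\<^sup>2 - (u + A) * (u + B)) - (- 2) * (2 * j) * (u + 1)) = j * ((A + 1) * (B + 1) - 8)"
          by (simp_all add: algebra_simps power2_eq_square)
        then show "2 * (u + 1)\<^sup>2 + (6 - A - B) * (1 - u) = (u - 1)\<^sup>2 + (u + A) * (u + B) - 0 * (2 * j) * (u + 1)"
          "0 * (u + 1)\<^sup>2 + j * (A + B - 2) * (1 - u) = j * ((u - 1)\<^sup>2 - (u + A) * (u + B)) - (- 2) * (2 * j) * (u + 1)"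
          unfolding that by simp_all
        show "0 * (u + 1)\<^sup>2 + (B - A) * (1 - u) = (u - 1) * (A - B) - 0 * (2 * j) * (u + 1)"
          "- 2 * j * (u + 1)\<^sup>2 + j * (A + B - 2) * (1 - u) = - j * ((u - 1) * (2 * u + A + B)) - 2 * (2 * j) * (u + 1)"
          by (simp_all add: algebra_simps power2_eq_square)
      qed
      consider "k = 1" | "k = 2" | "k = 3" | "k = 4" using exhaust_4 by blast
      then show ?thesis
      proof cases
        case 1
        show ?thesis unfolding 1 F vals
          by (rule sol[OF poly(1)[OF cc] w])
      next
        case 2
        show ?thesis unfolding 2 F vals
          by (rule sol[OF poly(2)[OF cc] w])
      next
        case 3
        show ?thesis unfolding 3 F vals
          by (rule sol[OF poly(3)[OF cc] w])
      next
        case 4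
        show ?thesis unfolding 4 F vals
          by (rule sol[OF poly(4)[OF cc] w])
      qed
    qed
    ultimately show ?thesis by simp
  qed
  moreover have "F k z - of_real (c k) * (1 / (z - \<i>)) + of_real (c k) * (1 / (z + \<i>))
      = F k z - of_real (c k) * (2 * \<i> / (z\<^sup>2 + 1))"
    unfolding log[symmetric] by (simp add: algebra_simps)
  ultimately show ?thesis
    by (simp only:)
qed


text \<open>
  Real residues of opposite sign make the logarithmic part single-valued after taking real parts.
\<close>

definition X :: "complex \<Rightarrow> real ^ 4" where
  "X z = (\<chi> k. Re (R k z) + c k * (ln (norm (z - \<i>)) - ln (norm (z + \<i>))))"

lemma X_deriv:
  assumes z: "z \<in> S"
  shows "(X has_derivative (\<lambda>v. \<chi> k. Re (F k z * v))) (at z)"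
proof (rule has_derivative_vec)
  fix k
  let ?q = "F k z - of_real (c k) * (1 / (z - \<i>)) + of_real (c k) * (1 / (z + \<i>))"
  have "((\<lambda>z. Re (R k z)) has_derivative (\<lambda>v. Re (?q * v))) (at z)"
    using has_derivative_Re[OF R_deriv[OF z, unfolded has_field_derivative_def]] .
  moreover have "((\<lambda>w. ln (norm (w - \<i>))) has_derivative (\<lambda>v. Re (1 / (z - \<i>) * v))) (at z)"
    "((\<lambda>w. ln (norm (w + \<i>))) has_derivative (\<lambda>v. Re (1 / (z + \<i>) * v))) (at z)"
    using has_derivative_ln_norm[of z "\<i>"] has_derivative_ln_norm[of z "- \<i>"] z by (simp_all add: S_iff(2))
  ultimately have "((\<lambda>z. Re (R k z) + c k * (ln (norm (z - \<i>)) - ln (norm (z + \<i>)))) has_derivative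
      (\<lambda>v. Re (?q * v) + c k * (Re (1 / (z - \<i>) * v) - Re (1 / (z + \<i>) * v)))) (at z)"
    by (intro has_derivative_add has_derivative_mult_right has_derivative_diff)
  moreover have "Re (?q * v) + c k * (Re (1 / (z - \<i>) * v) - Re (1 / (z + \<i>) * v)) = Re (F k z * v)" for v
  proof -
    have "Re (?q * v) + c k * (Re (1 / (z - \<i>) * v) - Re (1 / (z + \<i>) * v))
      = Re (?q * v + c k *\<^sub>R (1 / (z - \<i>) * v - 1 / (z + \<i>) * v))"
      by (simp only: plus_complex.sel minus_complex.sel scaleR_complex.sel)
    also have "?q * v + c k *\<^sub>R (1 / (z - \<i>) * v - 1 / (z + \<i>) * v) = F k z * v"
      by (simp add: scaleR_conv_of_real algebra_simps)
    finally show ?thesis .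
  qed
  ultimately show "((\<lambda>z. X z $ k) has_derivative (\<lambda>v. (\<chi> k. Re (F k z * v)) $ k)) (at z)"
    by (simp only: X_def vec_lambda_beta)
qed

lemma t_minus_s: "z \<in> S \<Longrightarrow> t e z - s z = (of_real e + 1) / (z\<^sup>2 + 1)"
  by (simp add: t_def s_def diff_divide_distrib[symmetric])

text \<open>
  The functions \<open>s\<close> and \<open>t e\<close> cannot be small together compared with \<open>1 / (z\<^sup>2 + 1)\<close>, because their
  difference is a constant multiple of it.
\<close>

lemma norm_sq_sum_ge:
  assumes z: "z \<in> S"
  shows "(e + 1)\<^sup>2 / 2 \<le> ((norm (s z))\<^sup>2 + (norm (t e z))\<^sup>2) * (norm (z\<^sup>2 + 1))\<^sup>2"
proof -
  have "norm (t e z - s z) * norm (z\<^sup>2 + 1) = norm (of_real (e + 1) :: complex)"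
    using z by (simp add: t_minus_s S_iff(1) norm_divide)
  then have "(e + 1)\<^sup>2 = (norm (t e z - s z))\<^sup>2 * (norm (z\<^sup>2 + 1))\<^sup>2"
    by (metis norm_of_real power2_abs power_mult_distrib)
  moreover have "(norm (t e z - s z))\<^sup>2 \<le> 2 * ((norm (s z))\<^sup>2 + (norm (t e z))\<^sup>2)"
    using norm_diff_square_le[of "t e z" "s z"] by (simp add: add.commute)
  ultimately have "(e + 1)\<^sup>2 \<le> 2 * ((norm (s z))\<^sup>2 + (norm (t e z))\<^sup>2) * (norm (z\<^sup>2 + 1))\<^sup>2"
    by (simp add: mult_right_mono)
  then show ?thesis by (simp only: mult.assoc)
qed

definition conformal_factor :: "complex \<Rightarrow> real" where
  "conformal_factor z = ((norm (s z))\<^sup>2 + (norm (t a z))\<^sup>2) * ((norm (s z))\<^sup>2 + (norm (t b z))\<^sup>2)"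

text \<open>
  The constant 4 is half of \<open>(a + 1) (b + 1) = 8\<close>. This lower bound makes the punctures \<open>\<plusminus>\<i>\<close> infinitely
  far away.
\<close>

lemma sqrt_conformal_factor_ge_inverse:
  assumes z: "z \<in> S"
  shows "4 / (norm (z\<^sup>2 + 1))\<^sup>2 \<le> sqrt (conformal_factor z)"
proof (rule real_le_rsqrt)
  let ?n = "norm (z\<^sup>2 + 1)"
  have n: "?n > 0" using z by (simp add: S_iff(1))
  have "16 = ((a + 1) * (b + 1))\<^sup>2 / 4"
    by (simp add: ab)
  also have "\<dots> = (a + 1)\<^sup>2 / 2 * ((b + 1)\<^sup>2 / 2)"
    by (simp add: power_mult_distrib)
  also have "\<dots> \<le> (((norm (s z))\<^sup>2 + (norm (t a z))\<^sup>2) * ?n\<^sup>2) * (((norm (s z))\<^sup>2 + (norm (t b z))\<^sup>2) * ?n\<^sup>2)"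
    by (intro mult_mono norm_sq_sum_ge z) auto
  also have "\<dots> = conformal_factor z * (?n\<^sup>2)\<^sup>2"
    by (simp add: conformal_factor_def power2_eq_square mult_ac)
  finally show "(4 / ?n\<^sup>2)\<^sup>2 \<le> conformal_factor z"
    using n by (simp add: divide_simps power_divide)
qed

lemma conformal_factor_pos: "z \<in> S \<Longrightarrow> conformal_factor z > 0"
proof -
  assume z: "z \<in> S"
  have "0 < 4 / (norm (z\<^sup>2 + 1))\<^sup>2" using z by (simp add: S_iff(1))
  then have "0 < sqrt (conformal_factor z)"
    using sqrt_conformal_factor_ge_inverse[OF z] by linarith
  then show ?thesis by simp
qed

text \<open>
  Where \<open>|z\<^sup>2 + 1| \<le> 4\<close> the previous bound applies; elsewhere \<open>|s| \<ge> 1 / 2\<close>, because numerator and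
  denominator of \<open>s\<close> differ by 2. This lower bound makes \<open>\<infinity>\<close> infinitely far away.
\<close>

lemma sqrt_conformal_factor_ge_quarter:
  assumes z: "z \<in> S"
  shows "1 / 4 \<le> sqrt (conformal_factor z)"
proof (cases "norm (z\<^sup>2 + 1) \<le> 4")
  case True
  have "0 < norm (z\<^sup>2 + 1)" using z by (simp add: S_iff(1))
  moreover have "(norm (z\<^sup>2 + 1))\<^sup>2 \<le> 4\<^sup>2"
    using True by (intro power_mono) auto
  ultimately have "1 / 4 \<le> 4 / (norm (z\<^sup>2 + 1))\<^sup>2"
    by (simp add: divide_simps)
  then show ?thesis
    using sqrt_conformal_factor_ge_inverse[OF z] by linarith
next
  case False
  have "norm (z\<^sup>2 + 1) \<le> norm (z\<^sup>2 - 1) + norm (2 :: complex)"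
    using norm_triangle_ineq[of "z\<^sup>2 - 1" 2] by (simp add: add.commute)
  then have "1 / 2 \<le> norm (s z)"
    using False S_iff(1) z by (simp add: s_def norm_divide divide_simps)
  then have "(1 / 2)\<^sup>2 \<le> (norm (s z))\<^sup>2"
    by (intro power_mono) auto
  then have "1 / 4 * (1 / 4) \<le> conformal_factor z"
    unfolding conformal_factor_def by (intro mult_mono) (auto simp: power2_eq_square intro: add_increasing2)
  then show ?thesis
    by (intro real_le_rsqrt) (simp add: power2_eq_square)
qed

sublocale isotropic_curve S X F
proof
  show "\<exists>k. F k z \<noteq> 0" if "z \<in> S" for z
  proof (rule ccontr)
    assume "\<nexists>k. F k z \<noteq> 0"
    then have "conformal_factor z = 0"
      unfolding conformal_factor_def null_curve_norm[symmetric] by simp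
    then show False
      using conformal_factor_pos[OF that] by simp
  qed
qed (rule open_S F_holomorphic X_deriv null_curve_isotropic; assumption?)+

lemma \<rho>_eq: "\<rho> z = conformal_factor z"
  by (simp add: \<rho>_def conformal_factor_def null_curve_norm)

text \<open>
  Path independence of the real periods: the rational part has a primitive, and the residues are real,
  so that only the real parts of the logarithmic integrals contribute.
\<close>

lemma Re_contour_integral_F:
  assumes \<gamma>: "valid_path \<gamma>" "path_image \<gamma> \<subseteq> S"
  shows "Re (contour_integral \<gamma> (F k)) = X (pathfinish \<gamma>) $ k - X (pathstart \<gamma>) $ k"
proof -
  let ?q = "\<lambda>z. F k z - of_real (c k) * (1 / (z - \<i>)) + of_real (c k) * (1 / (z + \<i>))"
  have q: "(?q has_contour_integral (R k (pathfinish \<gamma>) - R k (pathstart \<gamma>))) \<gamma>"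
    using \<gamma> by (intro contour_integral_primitive[of S, OF has_field_derivative_at_within[OF R_deriv]])
  have notin: "\<i> \<notin> path_image \<gamma>" "- \<i> \<notin> path_image \<gamma>"
    using \<gamma>(2) S_iff(2) by auto
  have int: "((\<lambda>w. 1 / (w - p)) has_contour_integral contour_integral \<gamma> (\<lambda>w. 1 / (w - p))) \<gamma>"
    if "p \<notin> path_image \<gamma>" for p
    using contour_integrable_inversediff[OF \<gamma>(1) that] by (rule has_contour_integral_integral)
  have "((\<lambda>z. ?q z + of_real (c k) * (1 / (z - \<i>)) - of_real (c k) * (1 / (z - (- \<i>))))
    has_contour_integral (R k (pathfinish \<gamma>) - R k (pathstart \<gamma>)
      + of_real (c k) * contour_integral \<gamma> (\<lambda>w. 1 / (w - \<i>))
      - of_real (c k) * contour_integral \<gamma> (\<lambda>w. 1 / (w - (- \<i>))))) \<gamma>"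
    by (intro has_contour_integral_add has_contour_integral_diff has_contour_integral_lmul q int notin)
  moreover have "(\<lambda>z. ?q z + of_real (c k) * (1 / (z - \<i>)) - of_real (c k) * (1 / (z - (- \<i>)))) = F k"
    by (rule ext) simp
  ultimately have "(F k has_contour_integral (R k (pathfinish \<gamma>) - R k (pathstart \<gamma>)
      + of_real (c k) * contour_integral \<gamma> (\<lambda>w. 1 / (w - \<i>))
      - of_real (c k) * contour_integral \<gamma> (\<lambda>w. 1 / (w - (- \<i>))))) \<gamma>"
    by (simp only:)
  then have "contour_integral \<gamma> (F k) = R k (pathfinish \<gamma>) - R k (pathstart \<gamma>)
      + of_real (c k) * contour_integral \<gamma> (\<lambda>w. 1 / (w - \<i>))
      - of_real (c k) * contour_integral \<gamma> (\<lambda>w. 1 / (w - (- \<i>)))"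
    by (rule contour_integral_unique)
  then have "Re (contour_integral \<gamma> (F k)) = Re (R k (pathfinish \<gamma>)) - Re (R k (pathstart \<gamma>))
      + c k * Re (contour_integral \<gamma> (\<lambda>w. 1 / (w - \<i>)))
      - c k * Re (contour_integral \<gamma> (\<lambda>w. 1 / (w - (- \<i>))))"
    by simp
  then show ?thesis
    unfolding Re_contour_integral_inverse_diff[OF \<gamma>(1) notin(1)] Re_contour_integral_inverse_diff[OF \<gamma>(1) notin(2)]
    by (simp add: X_def algebra_simps)
qed

lemma weierstrass_data:
  "weierstrass_data_on X S (\<lambda>z. (z\<^sup>2 + of_real a) / (z\<^sup>2 - 1)) (\<lambda>z. (z\<^sup>2 + of_real b) / (z\<^sup>2 - 1))
    (\<lambda>z. (z\<^sup>2 - 1)\<^sup>2 / (z\<^sup>2 + 1)\<^sup>2)" (is "weierstrass_data_on X S ?g\<^sub>1 ?g\<^sub>2 ?h")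
proof -
  define \<phi> where "\<phi> = weierstrass_form ?g\<^sub>1 ?g\<^sub>2 ?h"
  have \<phi>_eq: "2 * \<phi> k z = F k z" if "z \<in> S" for k z
    unfolding \<phi>_def by (rule weierstrass_form_eq[OF that])
  have \<phi>_eq': "\<phi> k z = F k z / 2" if "z \<in> S" for k z
    using \<phi>_eq[OF that, of k] by (metis nonzero_mult_div_cancel_left zero_neq_numeral)
  have int: "Re (contour_integral \<gamma> (\<lambda>w. 2 * \<phi> k w)) = X (pathfinish \<gamma>) $ k - X (pathstart \<gamma>) $ k"
    if "valid_path \<gamma>" "path_image \<gamma> \<subseteq> S" for \<gamma> k
  proof -
    have "contour_integral \<gamma> (\<lambda>w. 2 * \<phi> k w) = contour_integral \<gamma> (F k)"
      using that(2) \<phi>_eq by (intro contour_integral_eq) blast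
    then show ?thesis
      using Re_contour_integral_F[OF that, of k] by simp
  qed
  have hol: "\<phi> k holomorphic_on S" for k
  proof -
    have "(\<lambda>z. F k z / 2) holomorphic_on S"
      using F_holomorphic by (intro holomorphic_intros) auto
    then show ?thesis
      by (rule holomorphic_transform) (simp add: \<phi>_eq')
  qed
  show ?thesis
    unfolding weierstrass_data_on_def \<phi>_def[symmetric]
  proof (intro conjI allI ballI impI open_S connected_S hol)
    show "S \<noteq> {}" using S_iff(1)[of 0] by auto
    show "?g\<^sub>1 meromorphic_on S" "?g\<^sub>2 meromorphic_on S"
      by (intro meromorphic_intros)+
    show "?h holomorphic_on S"
      by (auto intro!: holomorphic_intros simp: S_iff(1))
    show "\<exists>k. \<phi> k z \<noteq> 0" if "z \<in> S" for z
    proof -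
      obtain k where "F k z \<noteq> 0"
        using no_common_zero \<open>z \<in> S\<close> by blast
      then have "\<phi> k z \<noteq> 0"
        using \<phi>_eq[OF that, of k] by auto
      then show ?thesis ..
    qed
    show "Re (contour_integral \<gamma> (\<phi> k)) = 0"
      if "valid_path \<gamma> \<and> path_image \<gamma> \<subseteq> S \<and> pathfinish \<gamma> = pathstart \<gamma>" for \<gamma> k
    proof -
      have "contour_integral \<gamma> (\<lambda>w. 2 * \<phi> k w) = 2 * contour_integral \<gamma> (\<phi> k)"
        using that hol open_S by (intro contour_integral_lmul contour_integrable_holomorphic_simple) auto
      then show ?thesis
        using int[of \<gamma> k] that by simp
    qed
    show "\<exists>z\<^sub>0\<in>S. \<exists>v. \<forall>\<gamma>. valid_path \<gamma> \<and> path_image \<gamma> \<subseteq> S \<and> pathstart \<gamma> = z\<^sub>0 \<longrightarrow>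
        X (pathfinish \<gamma>) = v + (\<chi> k. Re (contour_integral \<gamma> (\<lambda>w. 2 * \<phi> k w)))"
    proof (intro bexI exI allI impI)
      show "0 \<in> S" by (simp add: S_iff(1))
      show "X (pathfinish \<gamma>) = X 0 + (\<chi> k. Re (contour_integral \<gamma> (\<lambda>w. 2 * \<phi> k w)))"
        if "valid_path \<gamma> \<and> path_image \<gamma> \<subseteq> S \<and> pathstart \<gamma> = 0" for \<gamma>
        using that int[of \<gamma>] by (simp add: vec_eq_iff)
    qed
  qed
qed

text \<open>
  If \<open>|z + p| \<le> 3\<close>, then \<open>|z\<^sup>2 + 1| \<le> 3 |z - p|\<close> and the bound by \<open>4 / |z\<^sup>2 + 1|\<^sup>2\<close> applies. Otherwise
  \<open>|z - p| \<ge> 1\<close>, since \<open>p\<close> and \<open>-p\<close> have distance 2, and the constant bound applies.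
\<close>

lemma inverse_distance_le:
  assumes z: "z \<in> S" and p: "p \<in> {\<i>, - \<i>}"
  shows "1 / (norm (z - p))\<^sup>2 \<le> 4 * sqrt (conformal_factor z)"
proof (cases "norm (z + p) \<le> 3")
  case True
  have split: "z\<^sup>2 + 1 = (z - p) * (z + p)"
    using p by (auto simp: factor)
  have "(norm (z\<^sup>2 + 1))\<^sup>2 \<le> (norm (z - p))\<^sup>2 * 3\<^sup>2"
    unfolding split norm_mult power_mult_distrib using True by (intro mult_left_mono power_mono) auto
  moreover have "0 < norm (z\<^sup>2 + 1)" "0 < norm (z - p)"
    using z p by (auto simp: S_iff)
  ultimately have "1 / (norm (z - p))\<^sup>2 \<le> 9 / (norm (z\<^sup>2 + 1))\<^sup>2"
    by (simp add: field_simps)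
  also have "\<dots> \<le> 4 * (4 / (norm (z\<^sup>2 + 1))\<^sup>2)"
    by (simp add: divide_right_mono)
  finally show ?thesis
    using sqrt_conformal_factor_ge_inverse[OF z] by linarith
next
  case False
  have "norm (z + p) \<le> norm (z - p) + norm (2 * p)"
    using norm_triangle_ineq[of "z - p" "2 * p"] by (simp add: add.commute)
  moreover have "norm (2 * p) = 2"
    using p by (auto simp: norm_mult)
  ultimately have "1 \<le> norm (z - p)"
    using False by simp
  then have "1 / (norm (z - p))\<^sup>2 \<le> 1"
    using one_le_power[of "norm (z - p)" 2] by (simp add: divide_le_eq)
  then show ?thesis
    using sqrt_conformal_factor_ge_quarter[OF z] by linarith
qed

text \<open>
  The functions \<open>z / 4\<close> and \<open>1 / (4 (z - p))\<close> for \<open>p = \<plusminus>\<i>\<close> detect the three ends of the surface.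
\<close>

lemma complete: "complete_surface_on X S"
proof (rule complete_if_bounded_derivs)
  define e :: "complex \<Rightarrow> complex \<Rightarrow> complex" where "e p = (\<lambda>z. inverse (z - p) / 4)" for p
  let ?\<F> = "insert (\<lambda>z. z / 4) (e ` {\<i>, - \<i>})"
  have ne: "z - p \<noteq> 0" if "z \<in> S" "p \<in> {\<i>, - \<i>}" for z p
    using that by (auto simp: S_iff(2))
  show "finite ?\<F>" by simp
  have deriv_e: "(e p has_field_derivative - (inverse (z - p) * inverse (z - p)) / 4) (at z)" if "z - p \<noteq> 0" for z p
    unfolding e_def using that by (auto intro!: derivative_eq_intros )
  have e_holo: "e p holomorphic_on S" if "p \<in> {\<i>, - \<i>}" for p
    using deriv_e ne[OF _ that] open_S by (metis holomorphic_on_open)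
  have id_holo: "(\<lambda>z. z / 4) holomorphic_on S"
    by (intro holomorphic_intros) auto
  show "f holomorphic_on S" if "f \<in> ?\<F>" for f
    using that e_holo id_holo by blast
  show "norm (deriv f z) \<le> sqrt (\<rho> z)" if f: "f \<in> ?\<F>" and z: "z \<in> S" for f z
  proof -
    have "deriv (\<lambda>z. z / 4) z = 1 / 4"
      by (intro DERIV_imp_deriv) (auto intro!: derivative_eq_intros)
    then have "norm (deriv (\<lambda>z. z / 4) z) \<le> sqrt (\<rho> z)"
      unfolding \<rho>_eq using sqrt_conformal_factor_ge_quarter[OF z] by simp
    moreover have "norm (deriv (e p) z) \<le> sqrt (\<rho> z)" if p: "p \<in> {\<i>, - \<i>}" for p
    proof -
      have "norm (deriv (e p) z) = 1 / (norm (z - p))\<^sup>2 / 4"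
        unfolding DERIV_imp_deriv[OF deriv_e[OF ne[OF z p]]]
        by (simp add: norm_divide norm_mult norm_inverse power2_eq_square inverse_eq_divide)
      then show ?thesis
        unfolding \<rho>_eq using inverse_distance_le[OF z p] by simp
    qed
    ultimately show ?thesis
      using f by blast
  qed
  show "\<exists>K. compact K \<and> K \<subseteq> S \<and> {z \<in> S. \<forall>f\<in>?\<F>. norm (f z) \<le> M} \<subseteq> K" for M
  proof (intro exI conjI)
    let ?K = "cball 0 (4 * M) \<inter> (\<Inter>p\<in>{\<i>, - \<i>}. {z. 1 \<le> 4 * M * norm (z - p)})"
    show "compact ?K"
      by (intro compact_Int_closed compact_cball closed_INT ballI closed_Collect_le continuous_intros)
    show "?K \<subseteq> S"
      by (auto simp: S_iff(2))
    show "{z \<in> S. \<forall>f\<in>?\<F>. norm (f z) \<le> M} \<subseteq> ?K"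
    proof
      fix z assume z: "z \<in> {z \<in> S. \<forall>f\<in>?\<F>. norm (f z) \<le> M}"
      have far: "1 \<le> 4 * M * norm (z - p)" if p: "p \<in> {\<i>, - \<i>}" for p
      proof -
        have "norm (e p z) \<le> M"
          using z p by blast
        then have "1 / norm (z - p) / 4 \<le> M"
          by (simp only: e_def norm_divide norm_inverse) (simp add: inverse_eq_divide)
        moreover have "norm (z - p) > 0"
          using z ne[of z p] p by auto
        ultimately show ?thesis
          by (simp add: field_simps)
      qed
      have "norm (z / 4) \<le> M"
        using z by auto
      then show "z \<in> ?K"
        by (intro IntI INT_I CollectI far) (simp_all add: norm_divide)
    qed
  qed
qed

text \<open>
  The Wronskian of \<open>z\<^sup>2 - 1\<close> and \<open>z\<^sup>2 + d\<close> is \<open>-2 (d + 1) z\<close>, and the powers of the common denominator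
  \<open>z\<^sup>2 + 1\<close> cancel. Hence the density extends continuously over the punctures.
\<close>

lemma curvature_density_eq:
  assumes z: "z \<in> S"
  shows "gauss_curvature X z * sqrt (metric_det X z) =
    - 8 * ((a + 1)\<^sup>2 * (norm z)\<^sup>2 / ((norm (z\<^sup>2 - 1))\<^sup>2 + (norm (z\<^sup>2 + of_real a))\<^sup>2)\<^sup>2
         + (b + 1)\<^sup>2 * (norm z)\<^sup>2 / ((norm (z\<^sup>2 - 1))\<^sup>2 + (norm (z\<^sup>2 + of_real b))\<^sup>2)\<^sup>2)"
proof -
  have w: "z\<^sup>2 + 1 \<noteq> 0" using z by (simp add: S_iff(1))
  have t: "(norm (s z * deriv (t d) z - t d z * deriv s z))\<^sup>2 / ((norm (s z))\<^sup>2 + (norm (t d z))\<^sup>2)\<^sup>2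
    = 4 * ((d + 1)\<^sup>2 * (norm z)\<^sup>2 / ((norm (z\<^sup>2 - 1))\<^sup>2 + (norm (z\<^sup>2 + of_real d))\<^sup>2)\<^sup>2)" for d
  proof -
    let ?n = "norm (z\<^sup>2 + 1)"
    have n: "?n > 0" using w by simp
    have ds: "deriv s z = 4 * z / (z\<^sup>2 + 1)\<^sup>2"
      unfolding s_def using w
      by (intro DERIV_imp_deriv) (auto intro!: derivative_eq_intros simp: power2_eq_square algebra_simps)
    have dt: "deriv (t d) z = 2 * z * (1 - of_real d) / (z\<^sup>2 + 1)\<^sup>2"
      unfolding t_def using w
      by (intro DERIV_imp_deriv) (auto intro!: derivative_eq_intros simp: power2_eq_square algebra_simps)
    have "s z * deriv (t d) z - t d z * deriv s z
      = ((z\<^sup>2 - 1) * (2 * z * (1 - of_real d)) - (z\<^sup>2 + of_real d) * (4 * z)) / (z\<^sup>2 + 1) ^ 3"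
    proof -
      have "(p / W) * (x / W\<^sup>2) - (q / W) * (y / W\<^sup>2) = (p * x - q * y) / W ^ 3" for p q x y W :: complex
        by (simp add: diff_divide_distrib power2_eq_square power3_eq_cube mult.assoc)
      then show ?thesis
        unfolding ds dt by (simp only: s_def t_def)
    qed
    also have "(z\<^sup>2 - 1) * (2 * z * (1 - of_real d)) - (z\<^sup>2 + of_real d) * (4 * z)
      = - 2 * of_real (d + 1) * z * (z\<^sup>2 + 1)"
      by (simp add: algebra_simps)
    also have "\<dots> / (z\<^sup>2 + 1) ^ 3 = - 2 * of_real (d + 1) * z / (z\<^sup>2 + 1)\<^sup>2"
      using w by (simp add: power2_eq_square power3_eq_cube)
    finally have "norm (s z * deriv (t d) z - t d z * deriv s z) = 2 * \<bar>d + 1\<bar> * norm z / ?n\<^sup>2"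
      by (simp only: norm_divide norm_mult norm_power norm_of_real) simp
    then have num: "(norm (s z * deriv (t d) z - t d z * deriv s z))\<^sup>2 = 4 * (d + 1)\<^sup>2 * (norm z)\<^sup>2 / (?n\<^sup>2)\<^sup>2"
      by (simp add: power_divide power_mult_distrib)
    have den: "(norm (s z))\<^sup>2 + (norm (t d z))\<^sup>2 = ((norm (z\<^sup>2 - 1))\<^sup>2 + (norm (z\<^sup>2 + of_real d))\<^sup>2) / ?n\<^sup>2"
      unfolding s_def t_def norm_divide power_divide by (rule add_divide_distrib[symmetric])
    have frac: "(p / N\<^sup>2) / (q / N)\<^sup>2 = p / q\<^sup>2" if "N \<noteq> 0" for p q N :: real
      using that by (simp add: power_divide)
    have "?n\<^sup>2 \<noteq> 0"
      using n by simp
    then show ?thesis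
      unfolding num den frac[OF \<open>?n\<^sup>2 \<noteq> 0\<close>] by (simp only: mult.assoc times_divide_eq_right)
  qed
  show ?thesis
    unfolding curvature_density[OF z s_t_holomorphic(1,2,2) \<rho>_eq[unfolded conformal_factor_def]] t
    by (simp add: algebra_simps)
qed

lemma finite_curvature: "finite_total_curvature X S"
proof -
  let ?q = "\<lambda>d z. (norm z)\<^sup>2 / ((norm (z\<^sup>2 - 1))\<^sup>2 + (norm (z\<^sup>2 + complex_of_real d))\<^sup>2)\<^sup>2"
  have ne: "a + 1 \<noteq> 0" "b + 1 \<noteq> 0" using ab by auto
  have "integrable lborel (\<lambda>z. - 8 * ((a + 1)\<^sup>2 * ?q a z + (b + 1)\<^sup>2 * ?q b z))"
    by (intro integrable_mult_right Bochner_Integration.integrable_add integrable_density_term ne)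
  then have "set_integrable lborel S (\<lambda>z. - 8 * ((a + 1)\<^sup>2 * ?q a z + (b + 1)\<^sup>2 * ?q b z))"
    unfolding set_integrable_def using open_S by (intro integrable_mult_indicator) auto
  also have "?this \<longleftrightarrow> finite_total_curvature X S"
    unfolding finite_total_curvature_def
    by (rule set_integrable_cong) (simp_all add: curvature_density_eq)
  finally show ?thesis .
qed

end

section \<open>Existence of the complete surface and the total weights\<close>

theorem theorem4p6:
  fixes a b :: real and \<Sigma> :: "complex set" and g\<^sub>1 g\<^sub>2 h :: "complex \<Rightarrow> complex"
  assumes "(a + 1) * (b + 1) = 8"
    and "\<Sigma> = {z. Fin z \<in> UNIV - {Fin \<i>, Fin (- \<i>), Infty}}"
    and "g\<^sub>1 = (\<lambda>z. (z\<^sup>2 + of_real a) / (z\<^sup>2 - 1))"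
    and "g\<^sub>2 = (\<lambda>z. (z\<^sup>2 + of_real b) / (z\<^sup>2 - 1))"
    and "h = (\<lambda>z. (z\<^sup>2 - 1)\<^sup>2 / (z\<^sup>2 + 1)\<^sup>2)"
  shows "(\<exists>X :: complex \<Rightarrow> real ^ 4.
            minimal_surface_on X \<Sigma> \<and> weierstrass_data_on X \<Sigma> g\<^sub>1 g\<^sub>2 h \<and>
            complete_surface_on X \<Sigma> \<and> finite_total_curvature X \<Sigma>) \<and>
         total_weight g\<^sub>1 \<Sigma> = 5 / 2 \<and> total_weight g\<^sub>2 \<Sigma> = 5 / 2"
proof -
  interpret surface_family a b
    by unfold_locales (rule assms(1))
  have \<Sigma>: "\<Sigma> = twice_punctured_plane"
    using S_eq unfolding assms(2) by auto
  have ne: "complex_of_real a \<noteq> - 1" "complex_of_real b \<noteq> - 1"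
    using assms(1) by (auto simp: complex_eq_iff)
  interpret g\<^sub>1: even_quadratic_map "complex_of_real a" "\<lambda>z. (z\<^sup>2 + of_real a) / (z\<^sup>2 - 1)"
    by unfold_locales (use ne in auto)
  interpret g\<^sub>2: even_quadratic_map "complex_of_real b" "\<lambda>z. (z\<^sup>2 + of_real b) / (z\<^sup>2 - 1)"
    by unfold_locales (use ne in auto)
  show ?thesis
    unfolding assms(3-5) \<Sigma>
    using minimal weierstrass_data complete finite_curvature g\<^sub>1.total_weight g\<^sub>2.total_weight by blast
qed

end
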